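(* Let $d\ge1$ be an integer, $R>0$ and $C\in\mathbb{R}$. Let $\tilde W\in L^1_{\mathrm{rad},\mathrm{loc}}(\mathbb{R}^d)$, $W=\mathcal{Q}[\tilde W]$, $F\in L^1_{\mathrm{rad},R}(\mathbb{R}^{d+1})$, and $\tilde F=\mathcal{P}[F]$. Then $W*F=C$ a.e. on $B_{d+1}(0;R)$ if and only if $\tilde W*\tilde F=C$ a.e. on $B_d(0;R)$.
   Context: $L^1_{\mathrm{rad},\mathrm{loc}}(\mathbb{R}^n)$ is the space of locally integrable radial functions on $\mathbb{R}^n$, and $L^1_{\mathrm{rad},R}(\mathbb{R}^n)$ is its subspace of functions supported on $\overline{B_n(0;R)}$, where $B_n(0;R)$ is the open ball of radius $R$ centered at the origin of $\mathbb{R}^n$. The operator $\mathcal{P}:L^1_{\mathrm{rad},R}(\mathbb{R}^{d+1})\to L^1_{\mathrm{rad},R}(\mathbb{R}^d)$ is $$\mathcal{P}[F](x_1,\dots,x_d)=\int_{\mathbb{R}}F(x_1,\dots,x_d,x_{d+1})\,dx_{d+1}.$$ The operator $\mathcal{Q}:L^1_{\mathrm{rad},\mathrm{loc}}(\mathbb{R}^d)\to L^1_{\mathrm{rad},\mathrm{loc}}(\mathbb{R}^{d+1})$ is $$\mathcal{Q}[\tilde W](\mathbf{x})=\frac{1}{|S^d|}\int_{S^d}\tilde w\big(\mathrm{dist}(\langle\mathbf{v}\rangle,\mathbf{x})\big)\,dS(\mathbf{v}),\qquad \mathbf{x}\in\mathbb{R}^{d+1},$$ where $\tilde w$ is the radial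 profile of $\tilde W$, i.e. $\tilde w(|\tilde{\mathbf{x}}|)=\tilde W(\tilde{\mathbf{x}})$; $S^d$ is the unit sphere in $\mathbb{R}^{d+1}$ with surface measure $dS$ and total measure $|S^d|$; $\langle\mathbf{v}\rangle$ is the one-dimensional subspace of $\mathbb{R}^{d+1}$ spanned by $\mathbf{v}$; and $\mathrm{dist}$ is Euclidean distance. The convolutions $W*F$ and $\tilde W*\tilde F$ are taken in $\mathbb{R}^{d+1}$ and $\mathbb{R}^d$, respectively. *)

theory Defs
  imports "HOL-Analysis.Analysis"
begin

text \<open>
  Functions represent their classes modulo equality almost everywhere, so being radial and
  being supported in a ball are conditions up to Lebesgue null sets. The space
  $\mathbb{R}^{d+1}$ is rendered as the Euclidean space \<^typ>\<open>'a \<times> real\<close>, with \<^typ>\<open>'a\<close> of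
  dimension $d$.
\<close>

definition radial :: "('a::euclidean_space \<Rightarrow> real) \<Rightarrow> bool" where
  "radial F \<longleftrightarrow> (\<exists>f. AE x in lebesgue. F x = f (norm x))"

text \<open>
  The profile is determined up to null sets of radii. For almost every \<^term>\<open>x\<close>
  (in fact every \<^term>\<open>x \<noteq> 0\<close>), the value \<open>Q_op W x\<close> below does not depend on the choice,
  since \<open>infdist x (span {v})\<close> then has an absolutely continuous distribution.
\<close>

definition radial_profile :: "('a::euclidean_space \<Rightarrow> real) \<Rightarrow> real \<Rightarrow> real" where
  "radial_profile F = (SOME f. AE x in lebesgue. F x = f (norm x))"

definition L1_rad_loc :: "('a::euclidean_space \<Rightarrow> real) set" where
  "L1_rad_loc = {F. (\<forall>K. compact K \<longrightarrow> F absolutely_integrable_on K) \<and> radial F}"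

definition L1_rad_supp :: "real \<Rightarrow> ('a::euclidean_space \<Rightarrow> real) set" where
  "L1_rad_supp R = {F \<in> L1_rad_loc. AE x in lebesgue. x \<notin> cball 0 R \<longrightarrow> F x = 0}"

text \<open>
  Surface measure on the unit sphere of an $n$-dimensional space, as a measure on the ambient
  space: a Borel set $A$ of unit vectors has measure
  $n \cdot \lambda \{t v \mid v \in A,\ 0 < t < 1\}$. The completion is taken because the
  functions integrated against it are only Lebesgue measurable.
\<close>

definition sphere_measure :: "'a::euclidean_space measure" where
  "sphere_measure = completion (scale_measure (of_nat DIM('a))
     (distr (restrict_space lborel (ball 0 1)) borel (\<lambda>x. x /\<^sub>R norm x)))"

definition P_op :: "('a::euclidean_space \<times> real \<Rightarrow> real) \<Rightarrow> 'a \<Rightarrow> real" where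
  "P_op F x = (LINT t|lebesgue. F (x, t))"

definition Q_op :: "('a::euclidean_space \<Rightarrow> real) \<Rightarrow> 'a \<times> real \<Rightarrow> real" where
  "Q_op W x = 1 / measure sphere_measure (sphere (0::'a \<times> real) 1) *
     (LINT v:sphere 0 1|sphere_measure. radial_profile W (infdist x (span {v})))"

definition convolution :: "('a::euclidean_space \<Rightarrow> real) \<Rightarrow> ('a \<Rightarrow> real) \<Rightarrow> 'a \<Rightarrow> real" where
  "convolution G F x = (LINT y|lebesgue. G (x - y) * F y)"

end

theory Submission imports Defs begin

text \<open>
  Since \<open>F\<close> is radial and Lebesgue measure is rotation invariant, the convolution of \<open>F\<close> with
  $\tilde w(\mathrm{dist}(\langle v\rangle,\cdot))$ is, for every \<open>v\<close>, a rotated copy of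
  $(\tilde W * \tilde F) \circ \mathrm{pr}$ with $\mathrm{pr}$ the projection to $\mathbb{R}^d$.
  Averaging over \<open>v\<close> gives, for every radial test function $\varphi$,
  \[ \int (W * F)\,\varphi = \int (\tilde W * \tilde F)\,\mathcal{P}[\varphi]. \]
  If $\tilde W * \tilde F = C$ on the ball of radius \<open>R\<close>, indicator functions of
  balls as $\varphi$ show that the radial function $W * F - C$ has integral zero over all smaller
  concentric balls, hence vanishes there. Conversely, one uses
  $\varphi(x) = 1/(\pi\sqrt{\rho^2-|x|^2})$ on the ball of radius $\rho$, for which
  $\mathcal{P}[\varphi]$ is the indicator function of the ball of radius $\rho$ in $\mathbb{R}^d$.
\<close>

section \<open>Rotation invariance of Lebesgue measure\<close>

lemma lborel_distr_minus:
  fixes c :: "'a::euclidean_space"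
  shows "distr lborel borel (\<lambda>x. c - x) = lborel"
  using lborel_affine[of "-1" c] by (simp add: density_1)

lemma orthogonal_transformation_measurable:
  fixes T :: "'a::euclidean_space \<Rightarrow> 'a"
  assumes "orthogonal_transformation T"
  shows "T \<in> borel_measurable borel"
  using assms by (intro borel_measurable_continuous_onI linear_continuous_on
      linear_linear[THEN iffD2] orthogonal_transformation_linear)

lemma lborel_distr_orthogonal:
  fixes T :: "'a::euclidean_space \<Rightarrow> 'a"
  assumes T: "orthogonal_transformation T"
  shows "distr lborel borel T = lborel"
proof (rule measure_eqI)
  obtain S where S: "\<And>x. T (S x) = x" "\<And>x. S (T x) = x"
    using orthogonal_transformation_bij[OF T] by (metis bij_inv_eq_iff)
  have lin: "linear T" by (rule orthogonal_transformation_linear[OF T])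
  note [measurable] = orthogonal_transformation_measurable[OF T]
  have nT: "norm (T x) = norm x" for x
    by (rule orthogonal_transformation_norm[OF T])
  fix A assume "A \<in> sets (distr lborel borel T)"
  then have [measurable]: "A \<in> sets borel" by simp
  \<comment> \<open>Uniqueness of Haar measure: both sides are translation invariant, so Fubini's theorem makes
    their ratio computable on any set of finite positive measure, and the unit ball is fixed by \<open>T\<close>.\<close>
  let ?B = "ball 0 1 :: 'a set"
  have [measurable]: "?B \<in> sets borel" by (simp add: borel_open)
  let ?I = "indicator :: 'a set \<Rightarrow> 'a \<Rightarrow> ennreal"
  have shift: "(\<integral>\<^sup>+x. f (c + x) \<partial>lborel) = (\<integral>\<^sup>+x. f x \<partial>lborel)"
    if [measurable]: "f \<in> borel_measurable borel" for f :: "'a \<Rightarrow> ennreal" and c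
    by (subst (2) lborel_distr_plus[of c, symmetric], subst nn_integral_distr) auto
  have refl: "(\<integral>\<^sup>+x. f (c - x) \<partial>lborel) = (\<integral>\<^sup>+x. f x \<partial>lborel)"
    if [measurable]: "f \<in> borel_measurable borel" for f :: "'a \<Rightarrow> ennreal" and c
    by (subst (2) lborel_distr_minus[of c, symmetric], subst nn_integral_distr) auto
  have "emeasure lborel ?B * emeasure (distr lborel borel T) A
      = (\<integral>\<^sup>+y. (\<integral>\<^sup>+x. ?I ?B y * ?I A (T x) \<partial>lborel) \<partial>lborel)"
  proof -
    have "emeasure (distr lborel borel T) A = (\<integral>\<^sup>+x. ?I A (T x) \<partial>lborel)"
      by (simp add: nn_integral_distr flip: nn_integral_indicator)
    then show ?thesis
      by (simp add: nn_integral_cmult) (subst nn_integral_multc, simp_all add: borel_measurable_indicator)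
  qed
  \<comment> \<open>For fixed \<open>y\<close>, translating \<open>x\<close> by \<open>S y\<close>
    replaces \<open>T x\<close> by \<open>T x + y\<close>, since \<open>T (S y) = y\<close>.\<close>
  also have "\<dots> = (\<integral>\<^sup>+y. (\<integral>\<^sup>+x. ?I ?B y * ?I A (T (S y + x)) \<partial>lborel) \<partial>lborel)"
    by (intro nn_integral_cong shift[symmetric]) measurable
  also have "\<dots> = (\<integral>\<^sup>+y. (\<integral>\<^sup>+x. ?I ?B y * ?I A (T x + y) \<partial>lborel) \<partial>lborel)"
    by (simp add: linear_add[OF lin] S add.commute)
  also have "\<dots> = (\<integral>\<^sup>+x. (\<integral>\<^sup>+y. ?I ?B y * ?I A (T x + y) \<partial>lborel) \<partial>lborel)"
    by (rule lborel_pair.Fubini') measurable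
  \<comment> \<open>For fixed \<open>x\<close>, translating \<open>y\<close> by \<open>- T x\<close>
    moves the dependence on \<open>T\<close> from \<open>A\<close> to the ball.\<close>
  also have "\<dots> = (\<integral>\<^sup>+x. (\<integral>\<^sup>+y. ?I ?B (- T x + y) * ?I A (T x + (- T x + y)) \<partial>lborel) \<partial>lborel)"
    by (intro nn_integral_cong shift[symmetric]) measurable
  also have "\<dots> = (\<integral>\<^sup>+y. (\<integral>\<^sup>+x. ?I ?B (y - T x) * ?I A y \<partial>lborel) \<partial>lborel)"
    by simp (rule lborel_pair.Fubini', measurable)
  \<comment> \<open>The ball sees only norms, and \<open>T\<close> maps \<open>S y - x\<close>
    isometrically to \<open>y - T x\<close>. A reflection in \<open>x\<close> then removes
    \<open>S y\<close> and decouples the two integrals.\<close>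
  also have "\<dots> = (\<integral>\<^sup>+y. (\<integral>\<^sup>+x. ?I ?B (S y - x) * ?I A y \<partial>lborel) \<partial>lborel)"
  proof -
    have "norm (y - T x) = norm (S y - x)" for x y
      using nT[of "S y - x"] by (simp add: linear_diff[OF lin] S)
    then show ?thesis by (simp add: indicator_def)
  qed
  also have "\<dots> = (\<integral>\<^sup>+y. (\<integral>\<^sup>+x. ?I ?B x * ?I A y \<partial>lborel) \<partial>lborel)"
    by (intro nn_integral_cong refl) measurable
  also have "\<dots> = emeasure lborel ?B * emeasure lborel A"
    by (simp add: nn_integral_cmult nn_integral_multc)
  finally have "emeasure lborel ?B * emeasure (distr lborel borel T) A
    = emeasure lborel ?B * emeasure lborel A" .
  moreover have "emeasure lborel ?B \<noteq> 0"
    using content_ball_pos[of 1 "0::'a"] by (metis less_numeral_extra(1,3) measure_eq_emeasure_eq_ennreal measure_zero_top zero_ennreal_def order_refl ennreal_0)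
  moreover have "emeasure lborel ?B \<noteq> \<infinity>"
    using emeasure_lborel_ball_finite[of "0::'a" 1] by simp
  ultimately show "emeasure (distr lborel borel T) A = emeasure lborel A"
    by (simp add: ennreal_mult_cancel_left)
qed simp

text \<open>The witness is the reflection in the hyperplane orthogonal to \<open>a - b\<close>,
  which swaps \<open>a\<close> and \<open>b\<close> because their norms agree. For
  \<open>a = b\<close> the subtracted term vanishes and the map is the identity.\<close>

lemma orthogonal_transformation_exists_reflection:
  fixes a b :: "'a::euclidean_space"
  assumes "norm a = norm b"
  obtains T where "orthogonal_transformation T" "T a = b" "\<And>x. T (T x) = x"
proof -
  define u where "u = a - b"
  define T where "T x = x - (2 * (x \<bullet> u) / (u \<bullet> u)) *\<^sub>R u" for x
  have "a \<bullet> a = b \<bullet> b" using assms by (simp add: norm_eq)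
  then have *: "2 * (a \<bullet> u) = u \<bullet> u"
    by (simp add: u_def inner_diff inner_commute)
  have 1: "T a = b"
    using * by (cases "u = 0") (auto simp: T_def u_def)
  have 2: "T (T x) = x" for x
    by (cases "u = 0") (simp_all add: T_def inner_diff_left field_simps)
  have "orthogonal_transformation T"
    unfolding orthogonal_transformation_def
  proof
    show "linear T"
      by (rule linearI) (simp_all add: T_def inner_simps algebra_simps add_divide_distrib)
    show "\<forall>v w. T v \<bullet> T w = v \<bullet> w"
      by (cases "u = 0") (simp_all add: T_def inner_simps field_simps inner_commute)
  qed
  with 1 2 show thesis by (intro that)
qed

section \<open>Profiles of radial functions\<close>

lemma AE_lborel_scaleR:
  fixes c :: real
  assumes "c \<noteq> 0" "AE x in lborel. P (x::'a::euclidean_space)"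
  shows "AE x in lborel. P (c *\<^sub>R x)"
proof -
  obtain N where N: "N \<in> null_sets lborel" "{x. \<not> P x} \<subseteq> N"
    using assms(2) by (auto simp: eventually_ae_filter)
  then have [measurable]: "N \<in> sets borel" by auto
  have "AE x in density (distr lborel borel (\<lambda>x. 0 + c *\<^sub>R x)) (\<lambda>_. \<bar>c\<bar>^DIM('a)). x \<notin> N"
    using AE_not_in[OF N(1)] by (subst (asm) lborel_affine[OF assms(1), of 0])
  then have "AE x in lborel. c *\<^sub>R x \<notin> N"
    using assms(1) by (simp add: AE_density AE_distr_iff)
  then show ?thesis by eventually_elim (use N in auto)
qed

lemma AE_lborel_scaleR_iff:
  fixes c :: real
  assumes "c \<noteq> 0"
  shows "(AE x in lborel. P (c *\<^sub>R x)) \<longleftrightarrow> (AE x in lborel. P (x::'a::euclidean_space))"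
proof
  assume "AE x in lborel. P (c *\<^sub>R x)"
  from AE_lborel_scaleR[OF _ this, of "inverse c"] assms show "AE x in lborel. P x" by simp
qed (rule AE_lborel_scaleR[OF assms])

lemma AE_lborel_nonzero: "AE x in lborel. (x::'a::euclidean_space) \<noteq> 0"
  by (rule AE_lborel_singleton)

text \<open>For each fixed \<open>t > 0\<close> dilation by \<open>t\<close> preserves null sets,
  and Fubini's theorem exchanges the two quantifiers. The exchange needs a measurable predicate,
  hence the Borel null set \<open>N\<close> covering the exceptions.\<close>

lemma AE_lborel_dilations:
  assumes "AE x in lborel. P (x::'a::euclidean_space)"
  shows "AE x in lborel. AE t in lborel. t > 0 \<longrightarrow> P (t *\<^sub>R x)"
proof -
  obtain N where N: "N \<in> null_sets lborel" "{x. \<not> P x} \<subseteq> N"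
    using assms by (auto simp: eventually_ae_filter)
  then have [measurable]: "N \<in> sets borel" by auto
  have "AE t in lborel. AE x in lborel. t > 0 \<longrightarrow> t *\<^sub>R x \<notin> (N::'a set)"
  proof (rule AE_I2)
    fix t :: real
    show "AE x in lborel. t > 0 \<longrightarrow> t *\<^sub>R x \<notin> (N::'a set)"
      using AE_lborel_scaleR[OF _ AE_not_in[OF N(1)], of t] by (cases "t > 0") auto
  qed
  then have "AE x in lborel. AE t in lborel. t > (0::real) \<longrightarrow> t *\<^sub>R x \<notin> N"
    by (subst (asm) lborel_pair.AE_commute) measurable
  then show ?thesis
    by (elim eventually_mono) (use N in blast)
qed

lemma AE_lborel_ex: "AE x in lborel. P (x::'a::euclidean_space) \<Longrightarrow> \<exists>x. P x"
  by (rule eventually_happens'[of "ae_filter lborel"]) (simp_all add: ae_filter_eq_bot_iff)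

lemma AE_lborel_ex_pos:
  assumes "AE t in lborel. P (t::real)"
  shows "\<exists>t>0. P t"
proof (rule ccontr)
  assume "\<not> ?thesis"
  with assms have "AE t in lborel. t \<notin> {0<..<1::real}"
    by (auto elim!: eventually_mono)
  then have "{0<..<1::real} \<in> null_sets lborel"
    by (subst AE_iff_null_sets) auto
  then show False by (simp add: null_sets_def)
qed

text \<open>A substitute for polar coordinates. For \<open>x \<noteq> 0\<close>, almost every
  \<open>t\<close> makes \<open>norm x * t\<close> a good radius; by Fubini's theorem a single
  \<open>t > 0\<close> serves almost all \<open>x\<close>, and rescaling \<open>x\<close> removes
  it. The radius 0 may be bad because the origin is a null set.\<close>

lemma AE_norm_lborel:
  assumes "AE r in lborel. r > 0 \<longrightarrow> P r"
  shows "AE x in lborel. P (norm (x::'a::euclidean_space))"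
proof -
  obtain N where N: "N \<in> null_sets lborel" "{r. \<not> (r > 0 \<longrightarrow> P r)} \<subseteq> N"
    using assms by (auto simp: eventually_ae_filter)
  then have [measurable]: "N \<in> sets borel" by auto
  have "AE x in lborel. AE t in lborel. norm (x::'a) * t \<notin> N"
    using AE_lborel_nonzero
  proof eventually_elim
    fix x :: 'a assume "x \<noteq> 0"
    then show "AE t in lborel. norm x * t \<notin> N"
      using AE_lborel_scaleR[OF _ AE_not_in[OF N(1)], of "norm x"] by simp
  qed
  then have "AE t in lborel. AE x in lborel. norm (x::'a) * t \<notin> N"
    by (subst (asm) lborel_pair.AE_commute) measurable
  from AE_lborel_ex_pos[OF this] obtain t where t: "t > 0" "AE x in lborel. norm (x::'a) * t \<notin> N"
    by auto
  have "AE x in lborel. norm (x::'a) \<notin> N"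
  proof (rule iffD1[OF AE_lborel_scaleR_iff[of t]])
    show "AE x in lborel. norm (t *\<^sub>R (x::'a)) \<notin> N"
      using t by (simp add: mult.commute)
  qed (use t in simp)
  with AE_lborel_nonzero show ?thesis
  proof eventually_elim
    fix x :: 'a assume "x \<noteq> 0" "norm x \<notin> N"
    then show "P (norm x)" using subsetD[OF N(2), of "norm x"] by auto
  qed
qed

text \<open>
  By Fubini's theorem applied to $F(t x)$, for almost every \<open>x\<close> the profile agrees almost
  everywhere with the restriction of \<open>F\<close> to the ray through \<open>x\<close>.
\<close>

lemma radial_borel_profile:
  fixes F :: "'a::euclidean_space \<Rightarrow> real"
  assumes F: "F \<in> borel_measurable lebesgue" and f: "AE x in lebesgue. F x = f (norm x)"
  obtains g where "g \<in> borel_measurable borel" "AE r in lborel. r > 0 \<longrightarrow> f r = g r"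
proof -
  obtain F0 where F0[measurable]: "F0 \<in> borel_measurable borel" and *: "AE x in lborel. F x = F0 x"
    using completion_ex_borel_measurable_real[OF F] by auto
  have "AE x in lborel. F0 x = f (norm x)"
    using f[unfolded AE_completion_iff] * by eventually_elim simp
  then have "AE x in lborel. AE t in lborel. t > 0 \<longrightarrow> F0 (t *\<^sub>R x) = f (norm (t *\<^sub>R x))"
    by (rule AE_lborel_dilations)
  with AE_lborel_nonzero have "AE x in lborel. x \<noteq> 0 \<and> (AE t in lborel. t > 0 \<longrightarrow> F0 (t *\<^sub>R x) = f (norm (t *\<^sub>R x)))"
    by eventually_elim auto
  from AE_lborel_ex[OF this] obtain x where x: "x \<noteq> 0" 
    "AE t in lborel. t > 0 \<longrightarrow> F0 (t *\<^sub>R x) = f (norm (t *\<^sub>R x))"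
    by auto
  show ?thesis
  proof
    \<comment> \<open>Along one good ray, the point at distance \<open>r\<close> from the origin has
      norm \<open>r\<close>, so the Borel function \<open>F0\<close> restricted to that ray is a
      Borel version of the profile.\<close>
    show "(\<lambda>r. F0 ((r / norm x) *\<^sub>R x)) \<in> borel_measurable borel" by measurable
    show "AE r in lborel. r > 0 \<longrightarrow> f r = F0 ((r / norm x) *\<^sub>R x)"
      using AE_lborel_scaleR[OF _ x(2), of "inverse (norm x)"] x(1)
      by (auto elim!: eventually_mono simp: field_simps)
  qed
qed

section \<open>Averages over lines\<close>

lemma borel_measurable_fst_comp [measurable (raw)]:
  fixes f :: "'c \<Rightarrow> 'a::topological_space \<times> 'b::topological_space"
  assumes "f \<in> borel_measurable M"
  shows "(\<lambda>x. fst (f x)) \<in> borel_measurable M"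
  using borel_measurable_continuous_onI[OF continuous_on_fst[OF continuous_on_id]] assms
  by (rule measurable_compose[rotated])

lemma borel_measurable_snd_comp [measurable (raw)]:
  fixes f :: "'c \<Rightarrow> 'a::topological_space \<times> 'b::topological_space"
  assumes "f \<in> borel_measurable M"
  shows "(\<lambda>x. snd (f x)) \<in> borel_measurable M"
  using borel_measurable_continuous_onI[OF continuous_on_snd[OF continuous_on_id]] assms
  by (rule measurable_compose[rotated])

text \<open>The norm of the component of \<open>x\<close> orthogonal to \<open>u\<close>. For
  \<open>u = 0\<close> it is \<open>norm x\<close>, still the distance to the span. In this form it
  is visibly Borel in \<open>u\<close> and \<open>x\<close> jointly, as Fubini arguments
  require.\<close>

definition line_dist :: "'a::real_inner \<Rightarrow> 'a \<Rightarrow> real" where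
  "line_dist u x = norm (x - ((x \<bullet> u) / (u \<bullet> u)) *\<^sub>R u)"

lemma infdist_span_singleton:
  fixes x u :: "'a::euclidean_space"
  shows "infdist x (span {u}) = line_dist u x"
proof (rule antisym)
  let ?p = "((x \<bullet> u) / (u \<bullet> u)) *\<^sub>R u"
  have "?p \<in> span {u}" by (intro span_mul span_base) simp
  then show "infdist x (span {u}) \<le> line_dist u x"
    unfolding line_dist_def dist_norm[symmetric] by (rule infdist_le)
  have "line_dist u x \<le> dist x a" if a: "a \<in> span {u}" for a
  proof -
    obtain c where a: "a = c *\<^sub>R u"
      using a by (auto simp: span_singleton)
    \<comment> \<open>\<open>?p\<close> is the orthogonal projection of \<open>x\<close> to the
      line, so Pythagoras shows that no other point \<open>a\<close> of the line is closer.\<close>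
    have "orthogonal (x - ?p) (?p - a)"
      by (cases "u = 0") (simp_all add: orthogonal_def a inner_simps)
    from norm_add_Pythagorean[OF this] have "(norm (x - ?p))\<^sup>2 \<le> (norm (x - a))\<^sup>2"
      by simp
    then show ?thesis
      by (simp add: line_dist_def dist_norm norm_le_square)
  qed
  then show "line_dist u x \<le> infdist x (span {u})"
    using span_zero[of "{u}"] by (subst infdist_notempty) (auto intro!: cINF_greatest)
qed

lemma line_dist_measurable [measurable]:
  fixes f g :: "'b \<Rightarrow> 'a::euclidean_space"
  assumes [measurable]: "f \<in> borel_measurable M" "g \<in> borel_measurable M"
  shows "(\<lambda>x. line_dist (f x) (g x)) \<in> borel_measurable M"
  unfolding line_dist_def by measurable

lemma line_dist_orthogonal_transformation:
  assumes "orthogonal_transformation T"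
  shows "line_dist (T u) (T x) = line_dist u x"
proof -
  have "T (x - ((x \<bullet> u) / (u \<bullet> u)) *\<^sub>R u) = T x - ((T x \<bullet> T u) / (T u \<bullet> T u)) *\<^sub>R T u"
    using assms orthogonal_transformation_linear[OF assms]
    by (simp add: linear_diff linear_cmul orthogonal_transformation_def)
  then show ?thesis
    unfolding line_dist_def using orthogonal_transformation_norm[OF assms] by metis
qed

lemma line_dist_scaleR: "c \<noteq> 0 \<Longrightarrow> line_dist (c *\<^sub>R u) x = line_dist u x"
  by (simp add: line_dist_def)

lemma line_dist_vertical: "line_dist (0, 1::real) x = norm (fst x)"
  by (cases x) (simp add: line_dist_def inner_prod_def norm_prod_def)

text \<open>A reflection carries \<open>u\<close> to a multiple of the vertical unit vector, and the
  distance to the vertical axis is the norm of the first component. This turns any line into the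
  direction of fiber integration.\<close>

lemma line_dist_eq_norm_fst:
  fixes u :: "'a::euclidean_space \<times> real"
  assumes "u \<noteq> 0"
  shows "\<exists>T::'a \<times> real \<Rightarrow> 'a \<times> real. orthogonal_transformation T \<and> (\<forall>x. line_dist u x = norm (fst (T x)))"
proof -
  have "norm u = norm (norm u *\<^sub>R (0::'a, 1::real))"
    by (simp add: norm_prod_def)
  then obtain T :: "'a \<times> real \<Rightarrow> 'a \<times> real"
    where T: "orthogonal_transformation T" "T u = norm u *\<^sub>R (0::'a, 1::real)"
    by (rule orthogonal_transformation_exists_reflection)
  have "line_dist u x = norm (fst (T x))" for x
    using line_dist_orthogonal_transformation[OF T(1), of u x, symmetric] assms
    unfolding T(2) by (subst (asm) line_dist_scaleR) (auto simp: line_dist_vertical)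
  with T(1) show ?thesis by auto
qed

section \<open>From averages over the sphere to averages over the ball\<close>

text \<open>Preimages under \<open>f\<close> differ from those under \<open>g\<close> by subsets of
  a null set, so \<open>f\<close> is measurable for the completion. If \<open>g\<close> is not
  integrable, both integrals are 0 by convention.\<close>

lemma integral_completion_AE:
  fixes f g :: "'a \<Rightarrow> real"
  assumes "AE x in M. f x = g x" and [measurable]: "g \<in> borel_measurable M"
  shows "integral\<^sup>L (completion M) f = integral\<^sup>L M g"
proof -
  have ae: "AE x in completion M. f x = g x"
    using assms(1) by (rule AE_completion)
  have "f \<in> borel_measurable (completion M)"
  proof (rule measurableI)
    fix A :: "real set" assume [measurable]: "A \<in> sets borel"
    show "f -` A \<inter> space (completion M) \<in> sets (completion M)"
    proof (rule completion.in_sets_AE)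
      show "AE x in completion M. x \<in> g -` A \<inter> space M \<longleftrightarrow> x \<in> f -` A \<inter> space (completion M)"
        using ae by eventually_elim auto
      have "g -` A \<inter> space M \<in> sets M" by measurable
      then show "g -` A \<inter> space M \<in> sets (completion M)" by auto
    qed auto
  qed simp
  then have "integral\<^sup>L (completion M) f = integral\<^sup>L (completion M) g"
    by (rule integral_cong_AE) (use ae in \<open>auto intro: measurable_completion\<close>)
  also have "\<dots> = integral\<^sup>L M g"
    by (rule integral_completion) measurable
  finally show ?thesis .
qed

lemma integral_scale_measure_of_nat:
  fixes f :: "'a \<Rightarrow> real"
  assumes [measurable]: "f \<in> borel_measurable M"
  shows "integral\<^sup>L (scale_measure (of_nat n) M) f = real n * integral\<^sup>L M f"
proof -
  have "scale_measure (of_nat n) M = density M (\<lambda>_. ennreal (real n))"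
    by (rule measure_eqI) (auto simp: emeasure_density_const ennreal_of_nat_eq_real_of_nat)
  then show ?thesis
    by (simp add: integral_density)
qed

text \<open>For fixed \<open>u \<noteq> 0\<close> the distance is \<open>norm (fst z)\<close> up to
  an orthogonal map, which preserves Lebesgue measure; Fubini's theorem then exchanges
  \<open>u\<close> and \<open>x\<close>.\<close>

lemma AE_line_dist:
  assumes "AE r in lborel. r > 0 \<longrightarrow> P r"
  shows "AE x in lborel. AE u in lborel. P (line_dist u (x::'a::euclidean_space \<times> real))"
proof -
  obtain N where N: "N \<in> null_sets lborel" "{r. \<not> (r > 0 \<longrightarrow> P r)} \<subseteq> N"
    using assms by (auto simp: eventually_ae_filter)
  \<comment> \<open>Nonpositive radii are declared bad, which removes the guard
    \<open>r > 0\<close>. \<open>N'\<close> is not a null set, but distances are nonnegative and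
    almost never 0.\<close>
  define N' where "N' = N \<union> {..0}"
  have [measurable]: "N' \<in> sets borel" using N by (auto simp: N'_def)
  have "AE r in lborel. r > 0 \<longrightarrow> r \<notin> N'"
    using AE_not_in[OF N(1)] by eventually_elim (auto simp: N'_def)
  from AE_norm_lborel[OF this] have "AE y in lborel. norm (y::'a) \<notin> N'" .
  then have *: "AE z in lborel. norm (fst (z::'a \<times> real)) \<notin> N'"
    unfolding lborel_prod[symmetric]
    by (intro lborel_pair.AE_pair_measure) (measurable, auto elim!: eventually_mono)
  have "AE u in lborel. AE x in lborel. line_dist u (x::'a \<times> real) \<notin> N'"
    using AE_lborel_nonzero
  proof eventually_elim
    fix u :: "'a \<times> real" assume "u \<noteq> 0"
    then obtain T :: "'a \<times> real \<Rightarrow> 'a \<times> real" where T: "orthogonal_transformation T"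
      and eq: "\<And>x. line_dist u x = norm (fst (T x))"
      using line_dist_eq_norm_fst by blast
    note [measurable] = orthogonal_transformation_measurable[OF T]
    have "AE z in distr lborel borel T. norm (fst z) \<notin> N'"
      unfolding lborel_distr_orthogonal[OF T] by (rule *)
    then show "AE x in lborel. line_dist u x \<notin> N'"
      by (subst (asm) AE_distr_iff) (measurable, simp add: eq)
  qed
  then have "AE x in lborel. AE u in lborel. line_dist u (x::'a \<times> real) \<notin> N'"
    by (subst (asm) lborel_pair.AE_commute) measurable
  moreover have "P r" if "r \<notin> N'" "r \<ge> 0" for r
    using that subsetD[OF N(2), of r] by (auto simp: N'_def)
  moreover have "line_dist u x \<ge> 0" for u x :: "'a \<times> real"
    by (simp add: line_dist_def)
  ultimately show ?thesis
    by (auto elim!: eventually_mono)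
qed

text \<open>Up to completion and the factor \<open>DIM('a)\<close>, the sphere measure is the image
  of Lebesgue measure on the unit ball under normalization. The completion lets \<open>f\<close>
  deviate from the Borel function \<open>g\<close> on directions that almost no \<open>u\<close>
  takes.\<close>

lemma integral_sphere_measure:
  fixes f g :: "'a::euclidean_space \<Rightarrow> real"
  assumes [measurable]: "g \<in> borel_measurable borel"
    and N: "{v. f v \<noteq> g v} \<subseteq> N" "N \<in> sets borel"
    and ae: "AE u in lborel. u /\<^sub>R norm u \<notin> N"
  shows "(LINT v:sphere 0 1|sphere_measure. f v)
    = real DIM('a) * (LINT u:ball 0 1|lborel. g (u /\<^sub>R norm u))"
proof -
  let ?h = "\<lambda>u::'a. u /\<^sub>R norm u"
  define M where "M = distr (restrict_space lborel (ball 0 1)) borel ?h"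
  have h[measurable]: "?h \<in> borel_measurable borel" by measurable
  have h'[measurable]: "?h \<in> measurable (restrict_space lborel (ball 0 1)) borel"
    by (intro measurable_restrict_space1) measurable
  have [measurable_cong]: "sets M = sets borel" by (simp add: M_def)
  have [measurable]: "g \<in> borel_measurable (scale_measure (of_nat DIM('a)) M)"
    using assms(1) by (simp add: M_def cong: measurable_cong_sets)
  have [measurable]: "sphere (0::'a) 1 \<in> sets borel" "ball (0::'a) 1 \<in> sets borel"
    by (simp_all add: borel_closed borel_open)
  note N(2)[measurable]
  have "AE v in M. v \<notin> N"
    unfolding M_def using ae
    by (subst AE_distr_iff) (measurable, auto simp: AE_restrict_space_iff)
  then have "emeasure M N = 0"
    by (subst (asm) AE_iff_null_sets[symmetric]) auto
  then have "N \<in> null_sets (scale_measure (of_nat DIM('a)) M)"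
    by (auto simp: null_sets_def)
  from AE_not_in[OF this]
  have "AE v in scale_measure (of_nat DIM('a)) M.
      indicator (sphere 0 1) v *\<^sub>R f v = indicator (sphere 0 1) v *\<^sub>R g v"
    by eventually_elim (use N in auto)
  then have "(LINT v:sphere 0 1|sphere_measure. f v)
      = (LINT v|scale_measure (of_nat DIM('a)) M. indicator (sphere 0 1) v *\<^sub>R g v)"
    unfolding sphere_measure_def set_lebesgue_integral_def M_def[symmetric]
    by (rule integral_completion_AE) measurable
  also have "\<dots> = real DIM('a) * (LINT v|M. indicator (sphere 0 1) v *\<^sub>R g v)"
    by (rule integral_scale_measure_of_nat) measurable
  also have "(LINT v|M. indicator (sphere 0 1) v *\<^sub>R g v)
      = (LINT u:ball 0 1|lborel. indicator (sphere 0 1) (?h u) *\<^sub>R g (?h u))"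
    unfolding M_def set_lebesgue_integral_def
    by (subst integral_distr) (measurable, simp add: integral_restrict_space)
  also have "\<dots> = (LINT u:ball 0 1|lborel. g (?h u))"
    unfolding set_lebesgue_integral_def
  proof (rule integral_cong_AE)
    \<comment> \<open>Every \<open>u \<noteq> 0\<close> is normalized into the sphere;
      \<open>u = 0\<close> is sent to 0 and forms a null set.\<close>
    show "AE u in lborel. indicator (ball 0 1) u *\<^sub>R indicator (sphere 0 1) (?h u) *\<^sub>R g (?h u)
        = indicator (ball 0 1) u *\<^sub>R g (?h u)"
      using AE_lborel_nonzero by eventually_elim simp
  qed measurable
  finally show ?thesis .
qed

lemma measure_sphere_measure:
  "measure sphere_measure (sphere (0::'a::euclidean_space) 1)
    = real DIM('a) * measure lborel (ball (0::'a) 1)"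
proof -
  let ?S = "sphere_measure :: 'a measure"
  have [simp]: "sphere 0 1 \<in> sets ?S"
    by (simp add: sphere_measure_def)
  have "(LINT v:sphere 0 1|?S. 1) = real DIM('a) * (LINT u:ball (0::'a) 1|lborel. 1)"
    by (rule integral_sphere_measure[where N = "{}"]) auto
  then show ?thesis
    by (simp add: set_lebesgue_integral_def Int_absorb1 sets.sets_into_space)
qed

text \<open>The profile picked by \<open>radial_profile\<close> may be replaced by a Borel version
  \<open>w\<close>, because for almost every \<open>x\<close> the distances to almost all lines
  avoid the exceptional radii. The factor \<open>DIM('a \<times> real)\<close> cancels against the
  total mass, and normalizing \<open>u\<close> does not change the line.\<close>

lemma Q_op_AE:
  fixes W :: "'a::euclidean_space \<Rightarrow> real"
  assumes W: "W \<in> borel_measurable lebesgue" and rad: "radial W"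
  obtains w where "w \<in> borel_measurable borel" "AE y in lborel. W y = w (norm y)"
    "AE x in lborel. Q_op W x = (1 / measure lborel (ball (0::'a \<times> real) 1)) *
       (LINT u:ball 0 1|lborel. w (line_dist u x))"
proof -
  let ?f = "radial_profile W"
  have f: "AE x in lebesgue. W x = ?f (norm x)"
    unfolding radial_profile_def using rad[unfolded radial_def] by (rule someI_ex)
  obtain w where w[measurable]: "w \<in> borel_measurable borel"
    and ae: "AE r in lborel. r > 0 \<longrightarrow> ?f r = w r"
    using radial_borel_profile[OF W f] .
  have "AE y in lborel. W y = w (norm y)"
    using f[unfolded AE_completion_iff] AE_norm_lborel[OF ae] by eventually_elim simp
  moreover have "AE x in lborel. Q_op W x = (1 / measure lborel (ball (0::'a \<times> real) 1)) *
       (LINT u:ball 0 1|lborel. w (line_dist u x))"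
  proof -
    obtain N where N: "N \<in> null_sets lborel" "{r. \<not> (r > 0 \<longrightarrow> ?f r = w r)} \<subseteq> N"
      using ae by (auto simp: eventually_ae_filter)
    define N' where "N' = N \<union> {..0}"
    have [measurable]: "N' \<in> sets borel" using N by (auto simp: N'_def)
    have "AE r in lborel. r > 0 \<longrightarrow> r \<notin> N'"
      using AE_not_in[OF N(1)] by eventually_elim (auto simp: N'_def)
    from AE_line_dist[OF this] show ?thesis
    proof eventually_elim
      fix x :: "'a \<times> real"
      assume x: "AE u in lborel. line_dist u x \<notin> N'"
      have lin: "line_dist (u /\<^sub>R norm u) x = line_dist u x" for u
        by (cases "u = 0") (simp_all add: line_dist_scaleR)
      have "(LINT v:sphere 0 1|sphere_measure. ?f (infdist x (span {v})))
        = real DIM('a \<times> real) * (LINT u:ball 0 1|lborel. w (line_dist (u /\<^sub>R norm u) x))"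
      proof (rule integral_sphere_measure)
        show "{v. ?f (infdist x (span {v})) \<noteq> w (line_dist v x)} \<subseteq> {v. line_dist v x \<in> N'}"
        proof
          fix v assume "v \<in> {v. ?f (infdist x (span {v})) \<noteq> w (line_dist v x)}"
          then show "v \<in> {v. line_dist v x \<in> N'}"
            using subsetD[OF N(2), of "line_dist v x"] by (auto simp: N'_def infdist_span_singleton)
        qed
        show "{v. line_dist v x \<in> N'} \<in> sets borel" by measurable
        show "AE u in lborel. u /\<^sub>R norm u \<notin> {v. line_dist v x \<in> N'}"
          using x by (simp add: lin)
      qed measurable
      then show "Q_op W x = (1 / measure lborel (ball (0::'a \<times> real) 1)) *
          (LINT u:ball 0 1|lborel. w (line_dist u x))"
        unfolding Q_op_def by (simp add: measure_sphere_measure lin)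
    qed
  qed
  ultimately show thesis by (rule that[OF w])
qed

section \<open>Duality of averages and fiber integrals\<close>

lemma nn_integral_lborel_pair:
  fixes g :: "'a::euclidean_space \<times> 'b::euclidean_space \<Rightarrow> ennreal"
  assumes "g \<in> borel_measurable borel"
  shows "(\<integral>\<^sup>+z. g z \<partial>lborel) = (\<integral>\<^sup>+x. (\<integral>\<^sup>+y. g (x, y) \<partial>lborel) \<partial>lborel)"
  using lborel.nn_integral_fst[of g lborel] assms by (simp add: lborel_prod borel_prod)

lemma nn_integral_lborel_fst:
  fixes h :: "'a::euclidean_space \<Rightarrow> ennreal" and g :: "'a \<times> 'b::euclidean_space \<Rightarrow> ennreal"
  assumes [measurable]: "h \<in> borel_measurable borel" "g \<in> borel_measurable borel"
  shows "(\<integral>\<^sup>+z. h (fst z) * g z \<partial>lborel) = (\<integral>\<^sup>+y. h y * (\<integral>\<^sup>+t. g (y, t) \<partial>lborel) \<partial>lborel)"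
proof -
  have "(\<integral>\<^sup>+z. h (fst z) * g z \<partial>lborel) = (\<integral>\<^sup>+y. (\<integral>\<^sup>+t. h y * g (y, t) \<partial>lborel) \<partial>lborel)"
    by (subst nn_integral_lborel_pair) simp_all
  also have "\<dots> = (\<integral>\<^sup>+y. h y * (\<integral>\<^sup>+t. g (y, t) \<partial>lborel) \<partial>lborel)"
    by (intro nn_integral_cong nn_integral_cmult) measurable
  finally show ?thesis .
qed

lemma integral_lborel_fst:
  fixes h :: "'a::euclidean_space \<Rightarrow> real" and g :: "'a \<times> 'b::euclidean_space \<Rightarrow> real"
  assumes "integrable lborel (\<lambda>z. h (fst z) * g z)"
  shows "integrable lborel (\<lambda>y. h y * (LINT t|lborel. g (y, t)))"
    and "(LINT z|lborel. h (fst z) * g z) = (LINT y|lborel. h y * (LINT t|lborel. g (y, t)))"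
proof -
  have i: "integrable (lborel \<Otimes>\<^sub>M lborel) (\<lambda>z. h (fst z) * g z)"
    using assms by (simp add: lborel_prod)
  show "integrable lborel (\<lambda>y. h y * (LINT t|lborel. g (y, t)))"
    using lborel_pair.integrable_fst'[OF i] by simp
  show "(LINT z|lborel. h (fst z) * g z) = (LINT y|lborel. h y * (LINT t|lborel. g (y, t)))"
    using lborel_pair.integral_fst'[OF i] by (simp add: lborel_prod)
qed

text \<open>This is \<open>Q_op\<close> for a Borel profile \<open>w\<close>. The average runs over
  the ball instead of the sphere, as \<open>line_dist u x\<close> depends only on the direction of
  \<open>u\<close>.\<close>

definition line_average :: "(real \<Rightarrow> real) \<Rightarrow> 'a::euclidean_space \<Rightarrow> real" where
  "line_average w x = (1 / measure lborel (ball (0::'a) 1)) * (LINT u:ball 0 1|lborel. w (line_dist u x))"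

text \<open>This is \<open>P_op\<close> applied to the radial function with profile
  \<open>f\<close>.\<close>

definition fiber_integral :: "(real \<Rightarrow> real) \<Rightarrow> 'a::euclidean_space \<Rightarrow> real" where
  "fiber_integral f y = (LINT t|lborel. f (norm (y, t::real)))"

definition conv_fiber :: "(real \<Rightarrow> real) \<Rightarrow> (real \<Rightarrow> real) \<Rightarrow> 'a::euclidean_space \<Rightarrow> real" where
  "conv_fiber w f y = (LINT z|lborel. w (norm (y - z)) * fiber_integral f z)"

definition conv_average :: "(real \<Rightarrow> real) \<Rightarrow> (real \<Rightarrow> real) \<Rightarrow> 'a::euclidean_space \<Rightarrow> real" where
  "conv_average w f x = (LINT y|lborel. line_average w (x - y) * f (norm y))"

lemma line_average_measurable [measurable]:
  assumes [measurable]: "w \<in> borel_measurable borel"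
  shows "line_average w \<in> borel_measurable (borel :: 'a::euclidean_space measure)"
proof -
  have [measurable]: "ball (0::'a) 1 \<in> sets borel" by (simp add: borel_open)
  show ?thesis
    unfolding line_average_def set_lebesgue_integral_def by measurable
qed

lemma fiber_integral_measurable [measurable]:
  assumes [measurable]: "f \<in> borel_measurable borel"
  shows "fiber_integral f \<in> borel_measurable borel"
  unfolding fiber_integral_def by measurable

lemma conv_average_measurable [measurable]:
  assumes [measurable]: "w \<in> borel_measurable borel" "f \<in> borel_measurable borel"
  shows "conv_average w f \<in> borel_measurable borel"
  unfolding conv_average_def by measurable

lemma conv_fiber_measurable [measurable]:
  assumes [measurable]: "w \<in> borel_measurable borel" "f \<in> borel_measurable borel"
  shows "conv_fiber w f \<in> borel_measurable borel"
  unfolding conv_fiber_def by measurable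

text \<open>
  \<open>p\<close> is the profile of a test function with bounded fiber integrals. Integrating the kernel
  below in two different orders pairs \<open>W * F\<close> (\<open>conv_average\<close>) with the test function and
  $\tilde W * \tilde F$ (\<open>conv_fiber\<close>) with its image under $\mathcal{P}$.
\<close>

locale radial_pairing =
  fixes w f p :: "real \<Rightarrow> real" and R \<rho> :: real and K :: ennreal and dim :: "'a::euclidean_space itself"
  assumes w[measurable]: "w \<in> borel_measurable borel"
    and f[measurable]: "f \<in> borel_measurable borel"
    and p[measurable]: "p \<in> borel_measurable borel"
    and w_finite: "\<And>c. (\<integral>\<^sup>+y. ennreal \<bar>w (norm (y::'a))\<bar> * indicator (ball 0 c) y \<partial>lborel) < \<infinity>"
    and f_finite: "(\<integral>\<^sup>+z. ennreal \<bar>f (norm (z::'a \<times> real))\<bar> \<partial>lborel) < \<infinity>"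
    and f_supp: "\<And>r. r > R \<Longrightarrow> f r = 0"
    and p_nonneg: "\<And>r. p r \<ge> 0"
    and p_supp: "\<And>r. r \<ge> \<rho> \<Longrightarrow> p r = 0"
    and p_proj: "\<And>y. (\<integral>\<^sup>+t. ennreal (p (norm (y::'a, t::real))) \<partial>lborel) \<le> K"
    and K: "K < \<infinity>"
begin

text \<open>For \<open>z = (x, y)\<close>, the argument of \<open>w\<close> is the distance of
  \<open>x - y\<close> from the vertical axis.\<close>

definition kern :: "('a \<times> real) \<times> ('a \<times> real) \<Rightarrow> real" where
  "kern z = w (norm (fst (fst z) - fst (snd z))) * f (norm (snd z)) * p (norm (fst z))"

lemma kern_measurable [measurable]: "kern \<in> borel_measurable borel"
  unfolding kern_def by measurable

lemma proj_le: "(\<integral>\<^sup>+t. ennreal (p (norm (x::'a, t::real))) \<partial>lborel) \<le> indicator (ball 0 \<rho>) x * K"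
proof (cases "norm x < \<rho>")
  case False
  then have "norm (x, t) \<ge> \<rho>" for t :: real
    using norm_fst_le[of x t] by simp
  then show ?thesis by (simp add: p_supp)
qed (use p_proj in simp)

text \<open>By Tonelli's theorem both vertical coordinates are integrated out first. The fibers of
  \<open>p\<close> contribute at most \<open>K\<close> over the ball of radius
  \<open>\<rho>\<close>, those of \<open>f\<close> contribute only over norms up to
  \<open>R\<close>, so \<open>w\<close> is evaluated only below \<open>\<rho> + R\<close>, where it
  is integrable.\<close>

lemma integrable_kern: "integrable lborel kern"
proof (rule integrableI_bounded)
  have [measurable]: "ball (0::'a) r \<in> sets borel" for r by (simp add: borel_open)
  let ?e = "\<lambda>x y. ennreal \<bar>w (norm (x - y :: 'a))\<bar>"
  define A where "A y = (\<integral>\<^sup>+t. ennreal \<bar>f (norm (y::'a, t::real))\<bar> \<partial>lborel)" for y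
  have [measurable]: "A \<in> borel_measurable borel"
    unfolding A_def by measurable
  define B where "B = (\<integral>\<^sup>+y. ennreal \<bar>w (norm (y::'a))\<bar> * indicator (ball 0 (\<rho> + R)) y \<partial>lborel)"
  have "(\<integral>\<^sup>+z. ennreal (norm (kern z)) \<partial>lborel)
    = (\<integral>\<^sup>+x. (\<integral>\<^sup>+y. ennreal (norm (kern (x, y))) \<partial>lborel) \<partial>lborel)"
    by (rule nn_integral_lborel_pair) measurable
  also have "\<dots> = (\<integral>\<^sup>+x. (\<integral>\<^sup>+y. ?e (fst x) (fst y) * ennreal \<bar>f (norm (y :: 'a \<times> real))\<bar> \<partial>lborel)
      * ennreal (p (norm (x :: 'a \<times> real))) \<partial>lborel)"
    by (subst nn_integral_multc[symmetric])
      (simp_all add: kern_def abs_mult ennreal_mult p_nonneg)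
  also have "\<dots> = (\<integral>\<^sup>+x. (\<integral>\<^sup>+y. ?e (fst x) y * A y \<partial>lborel) * ennreal (p (norm (x :: 'a \<times> real))) \<partial>lborel)"
    unfolding A_def by (subst nn_integral_lborel_fst) measurable
  also have "\<dots> = (\<integral>\<^sup>+x. (\<integral>\<^sup>+y. ?e x y * A y \<partial>lborel)
      * (\<integral>\<^sup>+t. ennreal (p (norm (x, t :: real))) \<partial>lborel) \<partial>lborel)"
    by (rule nn_integral_lborel_fst) measurable
  also have "\<dots> \<le> (\<integral>\<^sup>+x. (\<integral>\<^sup>+y. ?e x y * A y \<partial>lborel) * (indicator (ball 0 \<rho>) x * K) \<partial>lborel)"
    by (intro nn_integral_mono mult_left_mono proj_le) simp
  also have "\<dots> = (\<integral>\<^sup>+x. (\<integral>\<^sup>+y. ?e x y * A y * (indicator (ball 0 \<rho>) x * K) \<partial>lborel) \<partial>lborel)"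
    by (subst nn_integral_multc) simp_all
  also have "\<dots> = (\<integral>\<^sup>+y. (\<integral>\<^sup>+x. ?e x y * A y * (indicator (ball 0 \<rho>) x * K) \<partial>lborel) \<partial>lborel)"
    by (rule lborel_pair.Fubini'[symmetric]) measurable
  also have "\<dots> = (\<integral>\<^sup>+y. (\<integral>\<^sup>+x. ?e x y * indicator (ball 0 \<rho>) x \<partial>lborel) * (A y * K) \<partial>lborel)"
    by (subst nn_integral_multc[symmetric]) (simp_all add: ac_simps)
  also have "\<dots> \<le> (\<integral>\<^sup>+y. B * (A y * K) \<partial>lborel)"
  proof (intro nn_integral_mono)
    fix y :: 'a
    show "(\<integral>\<^sup>+x. ?e x y * indicator (ball 0 \<rho>) x \<partial>lborel) * (A y * K) \<le> B * (A y * K)"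
    proof (cases "norm y \<le> R")
      case True
      have "(\<integral>\<^sup>+x. ?e x y * indicator (ball 0 \<rho>) x \<partial>lborel)
        = (\<integral>\<^sup>+x. ennreal \<bar>w (norm x)\<bar> * indicator (ball 0 \<rho>) (y + x) \<partial>lborel)"
        by (subst lborel_distr_plus[of y, symmetric], subst nn_integral_distr) simp_all
      also have "\<dots> \<le> B"
        unfolding B_def
      proof (intro nn_integral_mono mult_left_mono)
        fix x
        have "norm x < \<rho> + R" if "norm (y + x) < \<rho>"
          using that True norm_triangle_ineq[of "y + x" "- y"] by simp
        then show "indicator (ball 0 \<rho>) (y + x) \<le> (indicator (ball 0 (\<rho> + R)) x :: ennreal)"
          by (auto split: split_indicator)
      qed simp
      finally show ?thesis by (rule mult_right_mono) simp
    next
      case False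
      then have "norm (y, t) > R" for t :: real
        using norm_fst_le[of y t] by simp
      then show ?thesis by (simp add: A_def f_supp)
    qed
  qed
  also have "\<dots> = B * ((\<integral>\<^sup>+y. A y \<partial>lborel) * K)"
    by (simp add: nn_integral_cmult nn_integral_multc)
  also have "(\<integral>\<^sup>+y. A y \<partial>lborel) = (\<integral>\<^sup>+z. ennreal \<bar>f (norm (z::'a \<times> real))\<bar> \<partial>lborel)"
    using nn_integral_lborel_fst[of "\<lambda>_::'a. 1" "\<lambda>z. ennreal \<bar>f (norm (z::'a \<times> real))\<bar>"]
    by (simp add: A_def)
  also have "B * (\<dots> * K) < \<infinity>"
    using w_finite f_finite K by (simp add: B_def ennreal_mult_less_top)
  finally show "(\<integral>\<^sup>+z. ennreal (norm (kern z)) \<partial>lborel) < \<infinity>" .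
qed measurable

lemma integral_p:
  "integrable lborel (\<lambda>x::'a \<times> real. p (norm x))"
  "(LINT x::'a \<times> real|lborel. p (norm x)) = (LINT y::'a|lborel. fiber_integral p y)"
proof -
  have "(\<integral>\<^sup>+x. ennreal (norm (p (norm (x::'a \<times> real)))) \<partial>lborel)
    = (\<integral>\<^sup>+x. (\<integral>\<^sup>+t. ennreal (p (norm (x::'a, t::real))) \<partial>lborel) \<partial>lborel)"
    using p_nonneg by (simp add: nn_integral_lborel_pair)
  also have "\<dots> \<le> (\<integral>\<^sup>+x. K * indicator (ball 0 \<rho>) (x::'a) \<partial>lborel)"
    using proj_le by (intro nn_integral_mono) (simp add: mult.commute)
  also have "\<dots> < \<infinity>"
    using K emeasure_lborel_ball_finite[of "0::'a" \<rho>]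
    by (subst nn_integral_cmult_indicator) (simp_all add: ennreal_mult_less_top)
  finally show i: "integrable lborel (\<lambda>x::'a \<times> real. p (norm x))"
    by (intro integrableI_bounded) measurable
  show "(LINT x::'a \<times> real|lborel. p (norm x)) = (LINT y::'a|lborel. fiber_integral p y)"
    using integral_lborel_fst(2)[of "\<lambda>_::'a. 1" "\<lambda>x. p (norm x)"] i
    by (simp add: fiber_integral_def)
qed

text \<open>Integrating over the second point \<open>y\<close> first, its vertical coordinate
  produces \<open>fiber_integral f\<close>, and the result depends on \<open>x\<close> only through
  \<open>fst x\<close> and \<open>p\<close>. The vertical coordinate of \<open>x\<close> then
  produces \<open>fiber_integral p\<close>.\<close>

lemma kern_conv_fiber:
  shows "integrable lborel (\<lambda>y::'a. conv_fiber w f y * fiber_integral p y)"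
    and "(LINT z|lborel. kern z) = (LINT y::'a|lborel. conv_fiber w f y * fiber_integral p y)"
proof -
  have i: "integrable (lborel \<Otimes>\<^sub>M lborel) kern"
    using integrable_kern by (simp add: lborel_prod)
  have ae: "AE x in lborel. (LINT y|lborel. kern (x, y)) = conv_fiber w f (fst x) * p (norm x)"
    using lborel_pair.AE_integrable_fst'[OF i]
  proof eventually_elim
    fix x assume *: "integrable lborel (\<lambda>y. kern (x, y))"
    show "(LINT y|lborel. kern (x, y)) = conv_fiber w f (fst x) * p (norm x)"
    proof (cases "p (norm x) = 0")
      case False
      then have "integrable lborel (\<lambda>y. w (norm (fst x - fst y)) * f (norm (y :: 'a \<times> real)))"
        using integrable_mult_left[OF *, of "inverse (p (norm x))"]
        by (simp add: kern_def)
      from integral_lborel_fst(2)[OF this] show ?thesis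
        by (simp add: kern_def conv_fiber_def fiber_integral_def)
    qed (simp add: kern_def)
  qed
  have [measurable]: "(\<lambda>x. LINT y|lborel. kern (x, y)) \<in> borel_measurable borel"
    by measurable
  have i2: "integrable lborel (\<lambda>x. conv_fiber w f (fst x) * p (norm (x :: 'a \<times> real)))"
    using lborel_pair.integrable_fst'[OF i]
    by (rule integrable_cong_AE_imp) (use ae in \<open>auto elim: eventually_mono\<close>)
  show "integrable lborel (\<lambda>y::'a. conv_fiber w f y * fiber_integral p y)"
    using integral_lborel_fst(1)[OF i2] by (simp add: fiber_integral_def)
  have "(LINT z|lborel. kern z) = (LINT x|lborel. conv_fiber w f (fst x) * p (norm (x :: 'a \<times> real)))"
    using lborel_pair.integral_fst'[OF i] ae
    by (subst integral_cong_AE[OF _ _ ae, symmetric]) (simp_all add: lborel_prod)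
  also have "\<dots> = (LINT y::'a|lborel. conv_fiber w f y * fiber_integral p y)"
    using integral_lborel_fst(2)[OF i2] by (simp add: fiber_integral_def)
  finally show "(LINT z|lborel. kern z) = (LINT y::'a|lborel. conv_fiber w f y * fiber_integral p y)" .
qed

text \<open>The kernel with the line spanned by \<open>u\<close> in place of the vertical
  axis.\<close>

definition lkern :: "'a \<times> real \<Rightarrow> ('a \<times> real) \<times> ('a \<times> real) \<Rightarrow> real" where
  "lkern u z = w (line_dist u (fst z - snd z)) * f (norm (snd z)) * p (norm (fst z))"

text \<open>The orthogonal map that makes the line vertical is applied to both points at once. The
  factors with \<open>f\<close> and \<open>p\<close> depend only on norms and do not change.\<close>

lemma lkern_eq_kern:
  assumes "u \<noteq> 0"
  shows "\<exists>S :: ('a \<times> real) \<times> ('a \<times> real) \<Rightarrow> ('a \<times> real) \<times> ('a \<times> real).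
    orthogonal_transformation S \<and> (\<forall>z. lkern u z = kern (S z))"
proof -
  obtain T :: "'a \<times> real \<Rightarrow> 'a \<times> real" where T: "orthogonal_transformation T"
    and eq: "\<And>x. line_dist u x = norm (fst (T x))"
    using line_dist_eq_norm_fst[OF assms] by auto
  let ?S = "\<lambda>z. (T (fst z), T (snd z))"
  have lin: "linear T" by (rule orthogonal_transformation_linear[OF T])
  have "orthogonal_transformation ?S"
    unfolding orthogonal_transformation_def
  proof (intro conjI allI)
    show "linear ?S"
      by (rule linearI) (simp_all add: linear_add[OF lin] linear_cmul[OF lin])
    show "?S v \<bullet> ?S z = v \<bullet> z" for v z
    proof -
      have "T a \<bullet> T b = a \<bullet> b" for a b
        using T by (simp add: orthogonal_transformation_def del: split_paired_All)
      then show ?thesis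
        by (simp only: inner_prod_def[of v z] inner_prod_def[of "?S v" "?S z"] fst_conv snd_conv)
    qed
  qed
  moreover have "lkern u z = kern (?S z)" for z
    by (simp add: lkern_def kern_def eq linear_diff[OF lin] orthogonal_transformation_norm[OF T])
  ultimately show ?thesis by auto
qed

lemma lkern_integral:
  assumes "u \<noteq> 0"
  shows "integrable lborel (lkern u)" 
    and "(LINT z|lborel. lkern u z) = (LINT z|lborel. kern z)"
    and "(LINT z|lborel. \<bar>lkern u z\<bar>) = (LINT z|lborel. \<bar>kern z\<bar>)"
proof -
  obtain S :: "('a \<times> real) \<times> ('a \<times> real) \<Rightarrow> ('a \<times> real) \<times> ('a \<times> real)"
    where S: "orthogonal_transformation S" and eq: "\<And>z. lkern u z = kern (S z)"
    using lkern_eq_kern[OF assms] by auto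
  note [measurable] = orthogonal_transformation_measurable[OF S]
  have k: "integrable (distr lborel borel S) kern"
    using integrable_kern by (simp add: lborel_distr_orthogonal[OF S])
  show "integrable lborel (lkern u)"
    using integrable_distr[OF _ k] by (simp add: eq[abs_def])
  show "(LINT z|lborel. lkern u z) = (LINT z|lborel. kern z)"
    by (subst (2) lborel_distr_orthogonal[OF S, symmetric], subst integral_distr)
      (simp_all add: eq[abs_def])
  show "(LINT z|lborel. \<bar>lkern u z\<bar>) = (LINT z|lborel. \<bar>kern z\<bar>)"
    by (subst (2) lborel_distr_orthogonal[OF S, symmetric], subst integral_distr) (simp_all add: eq)
qed

text \<open>By rotation invariance the integral of \<open>lkern u\<close> is the same for all
  \<open>u \<noteq> 0\<close>. Averaging it over the unit ball and integrating over \<open>u\<close>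
  first turns the distance kernel into \<open>line_average w\<close>.\<close>

lemma kern_conv_average:
  shows "integrable lborel (\<lambda>x::'a \<times> real. conv_average w f x * p (norm x))"
    and "(LINT z|lborel. kern z) = (LINT x::'a \<times> real|lborel. conv_average w f x * p (norm x))"
proof -
  let ?B = "ball (0::'a \<times> real) 1"
  let ?b = "measure lborel ?B"
  have b: "?b > 0" by (rule content_ball_pos) simp
  have [measurable]: "?B \<in> sets borel" by (simp add: borel_open)
  have intB: "integrable lborel (indicator ?B :: _ \<Rightarrow> real)"
    using emeasure_lborel_ball_finite[of "0::'a \<times> real" 1]
    by (intro integrable_real_indicator) auto
  define q where "q = (\<lambda>(u, z). indicator ?B u * lkern u z)"
  have [measurable]: "q \<in> borel_measurable (lborel \<Otimes>\<^sub>M lborel)"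
    unfolding q_def lkern_def by (simp add: borel_prod lborel_prod) measurable
  have q: "integrable (lborel \<Otimes>\<^sub>M lborel) q"
  \<comment> \<open>The integral of the absolute value over \<open>z\<close> is also independent of
    \<open>u \<noteq> 0\<close>, and the ball of all \<open>u\<close> has finite measure.\<close>
  proof (rule lborel_pair.Fubini_integrable)
    show "AE u in lborel. integrable lborel (\<lambda>z. q (u, z))"
      using AE_lborel_nonzero by eventually_elim (simp add: q_def lkern_integral)
    have "integrable lborel (\<lambda>u. indicator ?B u * (LINT z|lborel. \<bar>kern z\<bar>))"
      using intB by simp
    then show "integrable lborel (\<lambda>u. LINT z|lborel. norm (q (u, z)))"
    proof (rule integrable_cong_AE_imp)
      show "AE u in lborel. indicator ?B u * (LINT z|lborel. \<bar>kern z\<bar>) = (LINT z|lborel. norm (q (u, z)))"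
        using AE_lborel_nonzero by eventually_elim (simp add: q_def lkern_integral abs_mult)
    qed measurable
  qed measurable
  have inner: "(LINT u|lborel. q (u, z)) = ?b * (line_average w (fst z - snd z) * f (norm (snd z)) * p (norm (fst z)))" for z
  proof -
    have "(LINT u|lborel. q (u, z)) = (LINT u|lborel. (indicator ?B u * w (line_dist u (fst z - snd z))) * (f (norm (snd z)) * p (norm (fst z))))"
      by (simp add: q_def lkern_def ac_simps)
    then show ?thesis
      using b by (simp add: line_average_def set_lebesgue_integral_def)
  qed
  have "(LINT z|lborel. (LINT u|lborel. q (u, z))) = (LINT u|lborel. (LINT z|lborel. q (u, z)))"
    using lborel_pair.Fubini_integral[of "\<lambda>u z. q (u, z)"] q by simp
  also have "\<dots> = (LINT u|lborel. indicator ?B u * (LINT z|lborel. kern z))"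
  proof (rule integral_cong_AE)
    show "AE u in lborel. (LINT z|lborel. q (u, z)) = indicator ?B u * (LINT z|lborel. kern z)"
      using AE_lborel_nonzero by eventually_elim (simp add: q_def lkern_integral)
  qed measurable
  finally have 1: "(LINT z|lborel. line_average w (fst z - snd z) * f (norm (snd z)) * p (norm (fst z :: 'a \<times> real))) = (LINT z|lborel. kern z)"
    using b by (simp add: inner)
  have "integrable lborel (\<lambda>z. LINT u|lborel. q (u, z))"
    using lborel_pair.integrable_snd[of "\<lambda>u z. q (u, z)"] q by simp
  then have i: "integrable (lborel \<Otimes>\<^sub>M lborel) (\<lambda>z. line_average w (fst z - snd z) * f (norm (snd z)) * p (norm (fst z :: 'a \<times> real)))"
    using b by (simp add: inner lborel_prod)
  show "integrable lborel (\<lambda>x::'a \<times> real. conv_average w f x * p (norm x))"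
    using lborel_pair.integrable_fst'[OF i] by (simp add: conv_average_def)
  show "(LINT z|lborel. kern z) = (LINT x::'a \<times> real|lborel. conv_average w f x * p (norm x))"
    using lborel_pair.integral_fst'[OF i] by (simp add: conv_average_def lborel_prod 1)
qed

end

section \<open>Radial functions determined by integrals over balls\<close>

text \<open>Let \<open>h\<close> be \<open>g - C\<close> cut off to a smaller ball. Its integrals
  over centered balls vanish, so its positive and negative parts have the same image measure on the
  radii. As \<open>g\<close> is radial, the two parts live on disjoint sets of radii, hence both
  vanish.\<close>

lemma AE_eq_const_if_ball_integrals:
  fixes g :: "'a::euclidean_space \<Rightarrow> real"
  assumes g[measurable]: "g \<in> borel_measurable borel"
    and rad: "\<And>x y. norm x = norm y \<Longrightarrow> g x = g y"
    and int: "\<And>\<rho>. 0 < \<rho> \<Longrightarrow> \<rho> < R \<Longrightarrow> set_integrable lborel (ball 0 \<rho>) g"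
    and eq: "\<And>\<rho>. 0 < \<rho> \<Longrightarrow> \<rho> < R \<Longrightarrow>
      (LINT x:ball 0 \<rho>|lborel. g x) = C * measure lborel (ball (0::'a) \<rho>)"
  shows "AE x in lborel. x \<in> ball 0 R \<longrightarrow> g x = C"
proof -
  have [measurable]: "ball (0::'a) s \<in> sets borel" for s by (simp add: borel_open)
  have main: "AE x in lborel. x \<in> ball 0 s \<longrightarrow> g x = C" if s: "0 < s" "s < R" for s
  proof -
    define h where "h x = indicator (ball 0 s) x * (g x - C)" for x
    have [measurable]: "h \<in> borel_measurable borel" unfolding h_def by measurable
    have intC: "integrable lborel (\<lambda>x::'a. indicator (ball 0 \<rho>) x * C)" for \<rho>
      using emeasure_lborel_ball_finite[of "0::'a" \<rho>]
      by (intro integrable_mult_left integrable_real_indicator) auto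
    have ball: "integrable lborel (\<lambda>x. indicator (ball 0 \<rho>) x * (g x - C))"
      "(LINT x|lborel. indicator (ball 0 \<rho>) x * (g x - C)) = 0" if "0 < \<rho>" "\<rho> < R" for \<rho>
      using int[OF that] eq[OF that] intC[of \<rho>]
      by (simp_all add: set_integrable_def set_lebesgue_integral_def right_diff_distrib)
    have h: "integrable lborel h"
      using ball(1)[OF s] by (simp add: h_def[abs_def])
    have hr: "(LINT x|lborel. h x * indicator {r<..} (norm x)) = 0" for r
    proof -
      have 1: "(LINT x|lborel. h x * indicator (ball 0 r) x) = 0"
      proof -
        consider "r \<le> 0" | "0 < r" "r < s" | "s \<le> r" by linarith
        then show ?thesis
        proof cases
          case 1 then show ?thesis by (simp add: ball_empty)
        next
          case 2
          then have *: "h x * indicator (ball 0 r) x = indicator (ball 0 r) x * (g x - C)" for x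
            by (auto simp: h_def split: split_indicator)
          show ?thesis unfolding * using 2 s ball(2)[of r] by simp
        next
          case 3
          then have *: "h x * indicator (ball 0 r) x = indicator (ball 0 s) x * (g x - C)" for x
            by (auto simp: h_def split: split_indicator)
          show ?thesis unfolding * using s ball(2)[of s] by simp
        qed
      qed
      \<comment> \<open>The open ball and the region \<open>norm x > r\<close> together miss only
        the sphere of radius \<open>r\<close>, a null set.\<close>
      have "AE r' in lborel. r' \<noteq> r" by (rule AE_lborel_singleton)
      then have "AE x in lborel. norm (x::'a) \<noteq> r"
        by (intro AE_norm_lborel) (auto elim: eventually_mono)
      then have "AE x in lborel. h x * indicator {r<..} (norm x) = h x - h x * indicator (ball 0 r) x"
        by eventually_elim (auto split: split_indicator)
      then have "(LINT x|lborel. h x * indicator {r<..} (norm x)) = (LINT x|lborel. h x - h x * indicator (ball 0 r) x)"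
        by (intro integral_cong_AE) measurable
      also have "\<dots> = (LINT x|lborel. h x) - (LINT x|lborel. h x * indicator (ball 0 r) x)"
        using h integrable_mult_indicator[OF _ h, of "ball 0 r"]
        by (intro Bochner_Integration.integral_diff) (simp_all add: mult.commute)
      also have "(LINT x|lborel. h x) = 0"
        using ball(2)[OF s] by (simp add: h_def[abs_def])
      finally show ?thesis using 1 by simp
    qed
    \<comment> \<open>The positive and negative parts of \<open>h\<close> have the same distribution along the radius.\<close>
    define M where "M k = distr (density lborel (\<lambda>x. ennreal (k x))) borel (norm :: 'a \<Rightarrow> real)" for k
    have M: "emeasure (M k) A = (\<integral>\<^sup>+x. ennreal (k x * indicator A (norm x)) \<partial>lborel)"
      if [measurable]: "k \<in> borel_measurable borel" "A \<in> sets borel" for k A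
    proof -
      have "norm -` A \<in> sets (borel :: 'a measure)"
        using measurable_sets[of norm borel borel A] by simp
      then have "emeasure (M k) A = (\<integral>\<^sup>+x. ennreal (k x) * indicator (norm -` A) x \<partial>lborel)"
        by (simp add: M_def emeasure_distr emeasure_density)
      also have "\<dots> = (\<integral>\<^sup>+x. ennreal (k x * indicator A (norm x)) \<partial>lborel)"
        by (intro nn_integral_cong) (simp split: split_indicator)
      finally show ?thesis .
    qed
    have fin: "(\<integral>\<^sup>+x. ennreal (k x * indicator A (norm x)) \<partial>lborel) < \<infinity>"
      if "integrable lborel k" for k :: "'a \<Rightarrow> real" and A
    proof -
      have "(\<integral>\<^sup>+x. ennreal (k x * indicator A (norm x)) \<partial>lborel) \<le> (\<integral>\<^sup>+x. ennreal (norm (k x)) \<partial>lborel)"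
        by (intro nn_integral_mono ennreal_leI) (auto split: split_indicator)
      with that show ?thesis by (auto simp: integrable_iff_bounded)
    qed
    have "M h = M (\<lambda>x. - h x)"
    proof (rule measure_eqI_lessThan)
      fix r
      let ?I = "\<lambda>x::'a. indicator {r<..} (norm x) :: real"
      have 1: "(\<integral>\<^sup>+x. ennreal (h x * ?I x) \<partial>lborel) < \<infinity>"
        and 2: "(\<integral>\<^sup>+x. ennreal (- h x * ?I x) \<partial>lborel) < \<infinity>"
        using h by (intro fin; simp)+
      have "integrable lborel (\<lambda>x. h x * ?I x)"
        by (rule Bochner_Integration.integrable_bound[OF h]) (measurable, auto split: split_indicator)
      from real_lebesgue_integral_def[OF this] hr[of r]
      have "enn2real (\<integral>\<^sup>+x. ennreal (h x * ?I x) \<partial>lborel) = enn2real (\<integral>\<^sup>+x. ennreal (- h x * ?I x) \<partial>lborel)"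
        by simp
      then have "(\<integral>\<^sup>+x. ennreal (h x * ?I x) \<partial>lborel) = (\<integral>\<^sup>+x. ennreal (- h x * ?I x) \<partial>lborel)"
        using 1 2 by (metis ennreal_enn2real infinity_ennreal_def)
      with 1 show "emeasure (M h) {r<..} < \<infinity>" "emeasure (M h) {r<..} = emeasure (M (\<lambda>x. - h x)) {r<..}"
        by (simp_all add: M)
    qed (simp_all add: M_def)
    obtain e :: 'a where e: "norm e = 1"
      using vector_choose_size[of 1] by auto
    \<comment> \<open>\<open>A\<close> collects the radii at which \<open>g\<close> exceeds
      \<open>C\<close>, read off along one ray. There \<open>h\<close> has its whole positive part,
      while \<open>- h\<close> is nonpositive.\<close>
    define A where "A = {r. g (r *\<^sub>R e) > C}"
    have [measurable]: "A \<in> sets borel" unfolding A_def by measurable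
    have A: "norm x \<in> A \<longleftrightarrow> g x > C" for x
      unfolding A_def using rad[of x "norm x *\<^sub>R e"] e by simp
    have "(\<integral>\<^sup>+x. ennreal (h x) \<partial>lborel) = emeasure (M h) A"
      by (subst M) (auto intro!: nn_integral_cong simp: h_def A ennreal_neg split: split_indicator)
    also have "\<dots> = emeasure (M (\<lambda>x. - h x)) A"
      using \<open>M h = M (\<lambda>x. - h x)\<close> by simp
    also have "\<dots> = (\<integral>\<^sup>+x. 0 \<partial>(lborel :: 'a measure))"
      by (subst M) (auto intro!: nn_integral_cong simp: h_def A ennreal_neg split: split_indicator)
    finally have 1: "(\<integral>\<^sup>+x. ennreal (h x) \<partial>lborel) = 0" by simp
    moreover have "(\<integral>\<^sup>+x. ennreal (- h x) \<partial>lborel) = 0"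
      using 1 \<open>M h = M (\<lambda>x. - h x)\<close> M[of h UNIV] M[of "\<lambda>x. - h x" UNIV] by simp
    ultimately have "AE x in lborel. ennreal (h x) = 0" "AE x in lborel. ennreal (- h x) = 0"
      by (simp_all add: nn_integral_0_iff_AE)
    then show ?thesis
      by eventually_elim (auto simp: h_def ennreal_eq_0_iff)
  qed
  show ?thesis
  proof (cases "R > 0")
    case R: True
    \<comment> \<open>The integrals are given for radii strictly below \<open>R\<close>, so the ball
      is exhausted by countably many smaller ones. Adding 2 keeps the radius positive for
      \<open>n = 0\<close>.\<close>
    have "AE x in lborel. \<forall>n. x \<in> ball 0 (R - R / (real n + 2)) \<longrightarrow> g x = C"
      unfolding AE_all_countable using R by (intro allI main) (auto simp: field_simps intro: add_pos_nonneg)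
    then show ?thesis
    proof eventually_elim
      fix x :: 'a assume *: "\<forall>n. x \<in> ball 0 (R - R / (real n + 2)) \<longrightarrow> g x = C"
      show "x \<in> ball 0 R \<longrightarrow> g x = C"
      proof
        assume x: "x \<in> ball 0 R"
        then obtain n where n: "R / (R - norm x) < real n" using reals_Archimedean2 by blast
        with x R have "R / (real n + 2) < R - norm x"
          by (simp add: field_simps)
        then have "x \<in> ball 0 (R - R / (real n + 2))" by simp
        with * show "g x = C" by blast
      qed
    qed
  next
    case False
    then have "ball (0::'a) R = {}" by (simp add: ball_empty)
    then show ?thesis unfolding \<open>ball 0 R = {}\<close> by simp
  qed
qed

text \<open>
  The radial function with this profile is mapped by $\mathcal{P}$ to the indicator function of a ball:
  this is the kernel inverting Abel's integral equation.
\<close>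

definition abel_weight :: "real \<Rightarrow> real \<Rightarrow> real" where
  "abel_weight \<rho> r = indicator {-\<rho><..<\<rho>} r / (pi * sqrt (\<rho>\<^sup>2 - r\<^sup>2))"

lemma abel_weight_measurable [measurable]: "abel_weight \<rho> \<in> borel_measurable borel"
  unfolding abel_weight_def by measurable

lemma abel_weight_nonneg: "abel_weight \<rho> r \<ge> 0"
proof (cases "r \<in> {-\<rho><..<\<rho>}")
  case True
  then have "r\<^sup>2 \<le> \<rho>\<^sup>2"
    by (intro abs_le_square_iff[THEN iffD1]) auto
  then show ?thesis
    by (simp add: abel_weight_def)
qed (simp add: abel_weight_def)

lemma abel_weight_eq_0: "r \<ge> \<rho> \<Longrightarrow> abel_weight \<rho> r = 0"
  by (simp add: abel_weight_def)

text \<open>The antiderivative \<open>arcsin (t / a) / pi\<close> rises by 1 across the interval.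
  The integrand is unbounded near the endpoints, so the fundamental theorem is used for nonnegative
  functions, with one-sided limits of the antiderivative.\<close>

lemma nn_integral_abel_weight:
  assumes "a > 0"
  shows "(\<integral>\<^sup>+t. ennreal (abel_weight a t) \<partial>lborel) = 1"
proof -
  define F where "F t = arcsin (t / a) / pi" for t
  let ?f = "\<lambda>t. 1 / (pi * sqrt (a\<^sup>2 - t\<^sup>2))"
  have pos: "a\<^sup>2 - t\<^sup>2 > 0" if "-a < t" "t < a" for t
    using that abs_square_less_1[of "t / a"] assms by (auto simp: field_simps)
  have D: "DERIV F t :> ?f t" if "-a < t" "t < a" for t
  proof -
    have "a\<^sup>2 - t\<^sup>2 = a\<^sup>2 * (1 - (t / a)\<^sup>2)"
      using assms by (simp add: field_simps)
    then have "sqrt (a\<^sup>2 - t\<^sup>2) = a * sqrt (1 - (t / a)\<^sup>2)"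
      using assms by (simp add: real_sqrt_mult)
    then show ?thesis
      unfolding F_def using that assms
      by (auto intro!: derivative_eq_intros simp: field_simps)
  qed
  have cont: "continuous_on {-a..a} F"
    unfolding F_def using assms by (intro continuous_intros) (auto simp: field_simps)
  have isC: "isCont ?f t" if "-a < t" "t < a" for t
    using pos[OF that] by (intro continuous_intros) auto
  have "((F \<circ> real_of_ereal) \<longlongrightarrow> F (-a)) (at_right (ereal (-a)))"
    "((F \<circ> real_of_ereal) \<longlongrightarrow> F a) (at_left (ereal a))"
    using continuous_on_Icc_at_rightD[OF cont] continuous_on_Icc_at_leftD[OF cont] assms
    by (simp_all add: ereal_tendsto_simps del: uminus_ereal.simps)
  then have "set_integrable lborel (einterval (ereal (-a)) (ereal a)) ?f"
    "(LBINT t=ereal (-a)..ereal a. ?f t) = F a - F (-a)"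
    using assms D isC
    by (intro interval_integral_FTC_nonneg[where F = F]; auto intro!: AE_I2 dest: pos)+
  moreover have "F a - F (-a) = 1"
    using assms by (simp add: F_def)
  ultimately have *: "integrable lborel (abel_weight a)" "(LINT t|lborel. abel_weight a t) = 1"
    using assms
    by (simp_all add: interval_lebesgue_integral_def set_lebesgue_integral_def set_integrable_def
        einterval_eq abel_weight_def[abs_def])
  then show ?thesis
    by (subst nn_integral_eq_integral) (simp_all add: abel_weight_nonneg)
qed

lemma norm_Pair_less_iff:
  assumes "norm y < \<rho>"
  shows "norm (y, t::real) < \<rho> \<longleftrightarrow> \<bar>t\<bar> < sqrt (\<rho>\<^sup>2 - (norm y)\<^sup>2)"
proof -
  have "norm (y, t) < \<rho> \<longleftrightarrow> sqrt ((norm y)\<^sup>2 + t\<^sup>2) < sqrt (\<rho>\<^sup>2)"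
    using assms norm_ge_zero[of y] by (simp add: norm_prod_def del: norm_ge_zero)
  also have "\<dots> \<longleftrightarrow> sqrt (t\<^sup>2) < sqrt (\<rho>\<^sup>2 - (norm y)\<^sup>2)"
    unfolding real_sqrt_less_iff by auto
  finally show ?thesis by simp
qed

text \<open>On the fiber over \<open>y\<close> inside the ball, the weight is again an Abel weight
  in \<open>t\<close>, with half chord length \<open>a\<close> in place of \<open>\<rho>\<close>,
  and its integral is 1 for every \<open>a > 0\<close>.\<close>

lemma nn_fiber_abel_weight:
  fixes y :: "'a::euclidean_space"
  shows "(\<integral>\<^sup>+t. ennreal (abel_weight \<rho> (norm (y, t::real))) \<partial>lborel) = indicator (ball 0 \<rho>) y"
proof (cases "norm y < \<rho>")
  case True
  define a where "a = sqrt (\<rho>\<^sup>2 - (norm y)\<^sup>2)"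
  have \<rho>: "\<rho> > 0" using True norm_ge_zero[of y] by linarith
  have y: "(norm y)\<^sup>2 < \<rho>\<^sup>2"
    using True by (intro power_strict_mono) auto
  have "abel_weight \<rho> (norm (y, t)) = abel_weight a t" for t :: real
  proof -
    have "norm (y, t) \<in> {-\<rho><..<\<rho>} \<longleftrightarrow> t \<in> {-a<..<a}"
      using norm_Pair_less_iff[OF True, of t] norm_ge_zero[of "(y, t)"] \<rho>
      unfolding a_def[symmetric] by (auto simp del: norm_ge_zero)
    moreover have "\<rho>\<^sup>2 - (norm (y, t))\<^sup>2 = a\<^sup>2 - t\<^sup>2"
      using y by (simp add: a_def norm_prod_def)
    ultimately show ?thesis
      by (simp add: abel_weight_def indicator_def del: greaterThanLessThan_iff)
  qed
  moreover have "a > 0" using y by (simp add: a_def)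
  ultimately show ?thesis
    using True by (simp add: nn_integral_abel_weight)
next
  case False
  then have "norm (y, t) \<ge> \<rho>" for t :: real
    using norm_fst_le[of y t] by simp
  then have "abel_weight \<rho> (norm (y, t)) = 0" for t :: real
    by (rule abel_weight_eq_0)
  then show ?thesis
    using False by simp
qed

section \<open>Convolutions of radial functions\<close>

lemma fiber_integral_cong_norm:
  fixes x y :: "'a::euclidean_space"
  shows "norm x = norm y \<Longrightarrow> fiber_integral f x = fiber_integral f y"
  by (simp add: fiber_integral_def norm_prod_def)

text \<open>Substituting an orthogonal map that takes \<open>x\<close> to \<open>y\<close> shows
  radiality at every point, not only almost everywhere, as
  \<open>AE_eq_const_if_ball_integrals\<close> requires.\<close>

lemma conv_fiber_cong_norm:
  fixes x y :: "'a::euclidean_space"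
  assumes [measurable]: "w \<in> borel_measurable borel" "f \<in> borel_measurable borel"
    and eq: "norm x = norm y"
  shows "conv_fiber w f x = conv_fiber w f y"
proof -
  obtain T where T: "orthogonal_transformation T" "T x = y"
    using orthogonal_transformation_exists_reflection[OF eq] by metis
  note [measurable] = orthogonal_transformation_measurable[OF T(1)]
  have "conv_fiber w f y = (LINT z|lborel. w (norm (T x - T z)) * fiber_integral f (T z))"
    unfolding conv_fiber_def T(2)
    by (subst lborel_distr_orthogonal[OF T(1), symmetric], subst integral_distr)
      (simp_all add: fiber_integral_def)
  also have "\<dots> = conv_fiber w f x"
    using orthogonal_transformation_norm[OF T(1)] orthogonal_transformation_linear[OF T(1)]
    by (simp add: conv_fiber_def fiber_integral_cong_norm[of "T _" _ f] flip: linear_diff)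
  finally show ?thesis by simp
qed

lemma line_average_orthogonal_transformation:
  fixes T :: "'a::euclidean_space \<Rightarrow> 'a"
  assumes [measurable]: "w \<in> borel_measurable borel" and T: "orthogonal_transformation T"
  shows "line_average w (T x) = line_average w x"
proof -
  note [measurable] = orthogonal_transformation_measurable[OF T]
  have [measurable]: "ball (0::'a) 1 \<in> sets borel" by (simp add: borel_open)
  have "(LINT u|lborel. indicator (ball 0 1) u * w (line_dist u (T x)))
    = (LINT u|lborel. indicator (ball 0 1) (T u) * w (line_dist (T u) (T x)))"
    by (subst lborel_distr_orthogonal[OF T, symmetric], subst integral_distr) simp_all
  then show ?thesis
    by (simp add: line_average_def set_lebesgue_integral_def indicator_def
        line_dist_orthogonal_transformation[OF T] orthogonal_transformation_norm[OF T])
qed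

lemma conv_average_cong_norm:
  fixes x y :: "'a::euclidean_space"
  assumes [measurable]: "w \<in> borel_measurable borel" "f \<in> borel_measurable borel"
    and eq: "norm x = norm y"
  shows "conv_average w f x = conv_average w f y"
proof -
  obtain T where T: "orthogonal_transformation T" "T x = y"
    using orthogonal_transformation_exists_reflection[OF eq] by metis
  note [measurable] = orthogonal_transformation_measurable[OF T(1)]
  have "conv_average w f y = (LINT z|lborel. line_average w (T x - T z) * f (norm (T z)))"
    unfolding conv_average_def T(2)
    by (subst lborel_distr_orthogonal[OF T(1), symmetric], subst integral_distr) simp_all
  also have "\<dots> = conv_average w f x"
    using orthogonal_transformation_linear[OF T(1)]
    by (simp add: conv_average_def orthogonal_transformation_norm[OF T(1)]
        line_average_orthogonal_transformation[OF _ T(1)] flip: linear_diff)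
  finally show ?thesis by simp
qed

lemma fiber_integral_indicator_le:
  "(\<integral>\<^sup>+t. ennreal (indicator {..<\<rho>} (norm (y::'a::euclidean_space, t::real))) \<partial>lborel) \<le> ennreal (2 * \<bar>\<rho>\<bar>)"
proof -
  have "(\<integral>\<^sup>+t. ennreal (indicator {..<\<rho>} (norm (y, t::real))) \<partial>lborel)
    \<le> (\<integral>\<^sup>+t. indicator {-\<bar>\<rho>\<bar>..\<bar>\<rho>\<bar>} t \<partial>lborel)"
  proof (intro nn_integral_mono)
    fix t :: real
    show "ennreal (indicator {..<\<rho>} (norm (y, t))) \<le> indicator {-\<bar>\<rho>\<bar>..\<bar>\<rho>\<bar>} t"
      using norm_snd_le[of t y] by (auto split: split_indicator)
  qed
  then show ?thesis by simp
qed

lemma fiber_integral_abel_weight: "fiber_integral (abel_weight \<rho>) y = indicator (ball 0 \<rho>) (y::'a::euclidean_space)"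
proof -
  have "fiber_integral (abel_weight \<rho>) y = enn2real (indicator (ball 0 \<rho>) y)"
    unfolding fiber_integral_def
    by (subst integral_eq_nn_integral) (simp_all add: abel_weight_nonneg nn_fiber_abel_weight)
  then show ?thesis by (simp split: split_indicator)
qed

lemma fiber_integral_indicator_eq_0:
  assumes "norm y \<ge> \<rho>"
  shows "fiber_integral (indicator {..<\<rho>}) (y::'a::euclidean_space) = 0"
proof -
  have "norm (y, t) \<ge> \<rho>" for t :: real
    using norm_fst_le[of y t] assms by simp
  then have "indicator {..<\<rho>} (norm (y, t)) = (0::real)" for t :: real
    by (simp add: not_less)
  then show ?thesis by (simp add: fiber_integral_def)
qed

lemma conv_average_eq_const_iff:
  fixes w f :: "real \<Rightarrow> real"
  assumes w[measurable]: "w \<in> borel_measurable borel" and f[measurable]: "f \<in> borel_measurable borel"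
    and w_finite: "\<And>c. (\<integral>\<^sup>+y. ennreal \<bar>w (norm (y::'a::euclidean_space))\<bar> * indicator (ball 0 c) y \<partial>lborel) < \<infinity>"
    and f_finite: "(\<integral>\<^sup>+z. ennreal \<bar>f (norm (z::'a \<times> real))\<bar> \<partial>lborel) < \<infinity>"
    and f_supp: "\<And>r. r > R \<Longrightarrow> f r = 0"
  shows "(AE x in lborel. x \<in> ball 0 R \<longrightarrow> conv_average w f (x::'a \<times> real) = C) \<longleftrightarrow>
    (AE y in lborel. y \<in> ball 0 R \<longrightarrow> conv_fiber w f (y::'a) = C)"
proof
  assume H: "AE x in lborel. x \<in> ball 0 R \<longrightarrow> conv_average w f (x::'a \<times> real) = C"
  show "AE y in lborel. y \<in> ball 0 R \<longrightarrow> conv_fiber w f (y::'a) = C"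
  proof (rule AE_eq_const_if_ball_integrals)
    fix \<rho> :: real assume \<rho>: "0 < \<rho>" "\<rho> < R"
    \<comment> \<open>The weight is unbounded, but its fiber integrals are ball indicators, so the
      bound 1 serves as \<open>K\<close>.\<close>
    interpret radial_pairing w f "abel_weight \<rho>" R \<rho> 1 "TYPE('a)"
      using w_finite f_finite f_supp
      by unfold_locales (auto simp: abel_weight_nonneg nn_fiber_abel_weight abel_weight_eq_0 split: split_indicator)
    show "set_integrable lborel (ball 0 \<rho>) (conv_fiber w f :: 'a \<Rightarrow> real)"
      using kern_conv_fiber(1) by (simp add: set_integrable_def fiber_integral_abel_weight mult.commute)
    have "(LINT y:ball (0::'a) \<rho>|lborel. conv_fiber w f y) = (LINT x::'a \<times> real|lborel. conv_average w f x * abel_weight \<rho> (norm x))"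
      using kern_conv_fiber(2) kern_conv_average(2)
      by (simp add: set_lebesgue_integral_def fiber_integral_abel_weight mult.commute)
    also have "\<dots> = (LINT x::'a \<times> real|lborel. C * abel_weight \<rho> (norm x))"
    proof (rule integral_cong_AE)
      \<comment> \<open>The weight is nonzero only for norms below \<open>\<rho> < R\<close>, where
        the hypothesis applies.\<close>
      show "AE x::'a \<times> real in lborel. conv_average w f x * abel_weight \<rho> (norm x) = C * abel_weight \<rho> (norm x)"
        using H by eventually_elim (use \<rho> in \<open>auto simp: abel_weight_def split: split_indicator\<close>)
    qed measurable
    \<comment> \<open>Integrated along fibers first, the weight has as total integral the volume of
      the ball in \<open>'a\<close>.\<close>
    also have "\<dots> = C * measure lborel (ball (0::'a) \<rho>)"
      using integral_p(2) emeasure_lborel_ball_finite[of "0::'a" \<rho>]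
      by (simp add: fiber_integral_abel_weight)
    finally show "(LINT y:ball (0::'a) \<rho>|lborel. conv_fiber w f y) = C * measure lborel (ball (0::'a) \<rho>)" .
  qed (use conv_fiber_cong_norm[OF w f] in auto)
next
  assume G: "AE y in lborel. y \<in> ball 0 R \<longrightarrow> conv_fiber w f (y::'a) = C"
  show "AE x in lborel. x \<in> ball 0 R \<longrightarrow> conv_average w f (x::'a \<times> real) = C"
  proof (rule AE_eq_const_if_ball_integrals)
    fix \<rho> :: real assume \<rho>: "0 < \<rho>" "\<rho> < R"
    let ?p = "indicator {..<\<rho>} :: real \<Rightarrow> real"
    \<comment> \<open>The bound \<open>2 * \<bar>\<rho>\<bar>\<close> is the largest length of a
      vertical chord of the ball.\<close>
    interpret radial_pairing w f ?p R \<rho> "ennreal (2 * \<bar>\<rho>\<bar>)" "TYPE('a)"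
      using w_finite f_finite f_supp fiber_integral_indicator_le by unfold_locales auto
    have p: "?p (norm x) = indicator (ball 0 \<rho>) x" for x :: "'a \<times> real"
      by (simp split: split_indicator)
    show "set_integrable lborel (ball 0 \<rho>) (conv_average w f :: 'a \<times> real \<Rightarrow> real)"
      using kern_conv_average(1) by (simp add: set_integrable_def p mult.commute)
    have "(LINT y:ball (0::'a \<times> real) \<rho>|lborel. conv_average w f y) = (LINT y::'a|lborel. conv_fiber w f y * fiber_integral ?p y)"
      using kern_conv_fiber(2) kern_conv_average(2)
      by (simp add: set_lebesgue_integral_def p mult.commute)
    also have "\<dots> = (LINT y::'a|lborel. C * fiber_integral ?p y)"
    proof (rule integral_cong_AE)
      show "AE y::'a in lborel. conv_fiber w f y * fiber_integral ?p y = C * fiber_integral ?p y"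
        using G
      proof eventually_elim
        fix y :: 'a assume "y \<in> ball 0 R \<longrightarrow> conv_fiber w f y = C"
        then show "conv_fiber w f y * fiber_integral ?p y = C * fiber_integral ?p y"
          using fiber_integral_indicator_eq_0[of \<rho> y] \<rho> by (cases "norm y < \<rho>") auto
      qed
    qed measurable
    also have "\<dots> = C * measure lborel (ball (0::'a \<times> real) \<rho>)"
      using integral_p(2) emeasure_lborel_ball_finite[of "0::'a \<times> real" \<rho>] by (simp add: p)
    finally show "(LINT y:ball (0::'a \<times> real) \<rho>|lborel. conv_average w f y) = C * measure lborel (ball (0::'a \<times> real) \<rho>)" .
  qed (use conv_average_cong_norm[OF w f] in auto)
qed

section \<open>Borel representatives of the given functions\<close>

lemma L1_rad_loc_measurable:
  assumes "F \<in> L1_rad_loc"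
  shows "F \<in> borel_measurable lebesgue"
proof (rule borel_measurable_LIMSEQ_real)
  fix n :: nat
  have "F absolutely_integrable_on cball 0 (real n)"
    using assms by (auto simp: L1_rad_loc_def)
  then show "(\<lambda>x. indicator (cball 0 (real n)) x * F x) \<in> borel_measurable lebesgue"
    by (auto simp: set_integrable_def dest: borel_measurable_integrable)
next
  fix x :: 'a
  obtain N :: nat where "norm x \<le> real N" using real_arch_simple by blast
  then have "\<forall>\<^sub>F n in sequentially. indicator (cball 0 (real n)) x * F x = F x"
    by (auto simp: eventually_sequentially intro!: exI[of _ N] split: split_indicator)
  then show "(\<lambda>n. indicator (cball 0 (real n)) x * F x) \<longlonglongrightarrow> F x"
    by (rule tendsto_eventually)
qed

lemma L1_rad_loc_profile_integrable:
  fixes F :: "'a::euclidean_space \<Rightarrow> real"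
  assumes F: "F \<in> L1_rad_loc" and w[measurable]: "w \<in> borel_measurable borel"
    and ae: "AE x in lborel. F x = w (norm x)"
  shows "(\<integral>\<^sup>+x. ennreal \<bar>w (norm (x::'a))\<bar> * indicator (cball 0 c) x \<partial>lborel) < \<infinity>"
proof -
  have [measurable]: "cball (0::'a) c \<in> sets borel" by (simp add: borel_closed)
  have F1: "integrable lebesgue (\<lambda>x. indicator (cball 0 c) x * F x)"
    using F by (auto simp: L1_rad_loc_def set_integrable_def)
  have "integrable lebesgue (\<lambda>x::'a. indicator (cball 0 c) x * w (norm x))"
    using F1
  proof (rule integrable_cong_AE_imp)
    show "(\<lambda>x::'a. indicator (cball 0 c) x * w (norm x)) \<in> borel_measurable lebesgue"
      by (rule measurable_completion) measurable
    show "AE x in lebesgue. indicator (cball 0 c) x * F x = indicator (cball 0 c) x * w (norm x)"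
      unfolding AE_completion_iff using ae by eventually_elim simp
  qed
  then have "integrable lborel (\<lambda>x::'a. indicator (cball 0 c) x * w (norm x))"
    by (subst (asm) integrable_completion) measurable
  then have "(\<integral>\<^sup>+x. ennreal (norm (indicator (cball 0 c) x * w (norm (x::'a)))) \<partial>lborel) < \<infinity>"
    by (simp add: integrable_iff_bounded)
  also have "(\<integral>\<^sup>+x. ennreal (norm (indicator (cball 0 c) x * w (norm (x::'a)))) \<partial>lborel)
    = (\<integral>\<^sup>+x. ennreal \<bar>w (norm (x::'a))\<bar> * indicator (cball 0 c) x \<partial>lborel)"
    by (intro nn_integral_cong) (simp split: split_indicator)
  finally show ?thesis .
qed

text \<open>The reflection of \<open>y\<close> to \<open>x - y\<close> preserves null sets, so
  representatives may be exchanged for every \<open>x\<close>, not just almost every one.\<close>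

lemma convolution_AE:
  fixes G F :: "'a::euclidean_space \<Rightarrow> real"
  assumes G: "AE y in lborel. G y = g y" and F: "AE y in lborel. F y = f y"
    and [measurable]: "g \<in> borel_measurable borel" "f \<in> borel_measurable borel"
  shows "convolution G F x = (LINT y|lborel. g (x - y) * f y)"
  unfolding convolution_def
proof (rule integral_completion_AE)
  have "AE y in distr lborel borel (\<lambda>y. x - y). G y = g y"
    unfolding lborel_distr_minus by (rule G)
  then have "AE y in lborel. G (x - y) = g (x - y)"
    by (rule AE_distrD[rotated]) measurable
  with F show "AE y in lborel. G (x - y) * F y = g (x - y) * f y"
    by eventually_elim simp
qed measurable

lemma P_op_AE:
  fixes F :: "'a::euclidean_space \<times> real \<Rightarrow> real"
  assumes F: "AE z in lborel. F z = f (norm z)" and [measurable]: "f \<in> borel_measurable borel"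
  shows "AE y in lborel. P_op F y = fiber_integral f y"
proof -
  have "AE y in lborel. AE t in lborel. F (y, t) = f (norm (y, t))"
    using F unfolding lborel_prod[symmetric] by (rule lborel_pair.AE_pair)
  then show ?thesis
  proof eventually_elim
    fix y assume "AE t in lborel. F (y, t) = f (norm (y, t))"
    then show "P_op F y = fiber_integral f y"
      unfolding P_op_def fiber_integral_def by (rule integral_completion_AE) measurable
  qed
qed

theorem lemma4p1:
  fixes R C :: real
    and W' F' :: "real ^ 'd \<Rightarrow> real"
    and W F :: "(real ^ 'd) \<times> real \<Rightarrow> real"
  assumes "R > 0"
    and "W' \<in> L1_rad_loc"
    and "W = Q_op W'"
    and "F \<in> L1_rad_supp R"
    and "F' = P_op F"
  shows "(AE x in lebesgue. x \<in> ball 0 R \<longrightarrow> convolution W F x = C) \<longleftrightarrow>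
         (AE x in lebesgue. x \<in> ball 0 R \<longrightarrow> convolution W' F' x = C)"
proof -
  have F: "F \<in> L1_rad_loc" and supp: "AE x in lborel. x \<notin> cball 0 R \<longrightarrow> F x = 0"
    using assms(4) by (simp_all add: L1_rad_supp_def AE_completion_iff)
  have "radial W'" using assms(2) by (simp add: L1_rad_loc_def)
  from Q_op_AE[OF L1_rad_loc_measurable[OF assms(2)] this]
  obtain w where w[measurable]: "w \<in> borel_measurable borel"
    and W': "AE y in lborel. W' y = w (norm y)"
    and W: "AE x in lborel. W x = line_average w x"
    unfolding line_average_def assms(3) by blast
  obtain f1 where f1: "AE x in lebesgue. F x = f1 (norm x)"
    using F by (auto simp: L1_rad_loc_def radial_def)
  from radial_borel_profile[OF L1_rad_loc_measurable[OF F] f1]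
  obtain f0 where f0[measurable]: "f0 \<in> borel_measurable borel"
    and ae: "AE r in lborel. r > 0 \<longrightarrow> f1 r = f0 r" .
  have F0: "AE x in lborel. F x = f0 (norm x)"
    using f1[unfolded AE_completion_iff] AE_norm_lborel[OF ae] by eventually_elim simp
  \<comment> \<open>The support condition on \<open>F\<close> holds only almost everywhere; cutting
    off the profile makes it hold at every radius, as \<open>radial_pairing\<close>
    requires.\<close>
  define f where "f r = f0 r * indicator {..R} r" for r
  have f[measurable]: "f \<in> borel_measurable borel" unfolding f_def by measurable
  have Ff: "AE x in lborel. F x = f (norm x)"
    using F0 supp by eventually_elim (auto simp: f_def split: split_indicator)
  have F': "AE y in lborel. F' y = fiber_integral f y"
    unfolding assms(5) by (rule P_op_AE[OF Ff f])
  have 1: "convolution W F x = conv_average w f x" for x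
    unfolding conv_average_def by (rule convolution_AE[OF W Ff]) measurable
  have 2: "convolution W' F' x = conv_fiber w f x" for x
    unfolding conv_fiber_def by (rule convolution_AE[OF W' F']) measurable
  have w_finite: "(\<integral>\<^sup>+y. ennreal \<bar>w (norm (y::real^'d))\<bar> * indicator (ball 0 c) y \<partial>lborel) < \<infinity>" for c
  proof (rule le_less_trans)
    show "(\<integral>\<^sup>+y. ennreal \<bar>w (norm (y::real^'d))\<bar> * indicator (ball 0 c) y \<partial>lborel)
      \<le> (\<integral>\<^sup>+y. ennreal \<bar>w (norm (y::real^'d))\<bar> * indicator (cball 0 c) y \<partial>lborel)"
      by (intro nn_integral_mono mult_left_mono) (auto split: split_indicator)
  qed (rule L1_rad_loc_profile_integrable[OF assms(2) w W'])
  have "(\<integral>\<^sup>+z. ennreal \<bar>f (norm (z::(real^'d) \<times> real))\<bar> \<partial>lborel)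
    = (\<integral>\<^sup>+z. ennreal \<bar>f (norm (z::(real^'d) \<times> real))\<bar> * indicator (cball 0 R) z \<partial>lborel)"
    by (intro nn_integral_cong) (auto simp: f_def split: split_indicator)
  also have "\<dots> < \<infinity>"
    by (rule L1_rad_loc_profile_integrable[OF F f Ff])
  finally show ?thesis
    unfolding AE_completion_iff 1 2
    by (intro conv_average_eq_const_iff w f w_finite) (simp_all add: f_def)
qed

end
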